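(* Let $(\tau,p)$ be an unbounded probabilistic context tree on a countable alphabet $A$, let $0<\epsilon<1$, and suppose that $(\tau,p)$ has an $\epsilon$-regular reference string $w$ with associated function $\ell^{w}:\mathbb{N}\to\mathbb{N}$ satisfying $$\limsup_{k\to\infty}\frac{\log(\ell^{w}(k))}{C_{\epsilon}\,k}<1,\qquad C_{\epsilon}:=-\frac{1}{|w|}\log\bigl(1-\epsilon^{|w|}\bigr)>0 .$$ Then there exists a unique (in law) stationary chain compatible with $(\tau,p)$, and the outputs of the perfect simulation algorithm are samples of it: the chain $X(\mathbf{U})$ is stationary and compatible with $(\tau,p)$, its law $\mu:=\mathbb{P}(X(\mathbf{U})\in\cdot)$ is the law of this unique stationary compatible chain, and for all integers $m\le n$ the constructed string $[X(\mathbf{U})]_m^n$ is distributed as the marginal of $\mu$ on the coordinates $m,\ldots,n$.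
   Context: Strings: $\mathbb{N}=\{0,1,2,\ldots\}$. For a countable alphabet $A$, $a_m^n$ denotes the string $a_m\ldots a_n$, of length $n-m+1$ (with $a_{n+1}^n=\emptyset$). $A^{-\mathbb{N}}=A^{\{\ldots,-2,-1\}}$ is the set of infinite pasts and $A^\star=\bigcup_{j\ge 0}A^{\{-j,\ldots,-1\}}$ the set of finite strings (including the empty string $\emptyset$). A string $s$ is a suffix of $v$ if $|s|\le|v|$ and $v_{-|s|}^{-1}=s$. Context trees: A tree is a subset $\tau\subset A^\star\cup A^{-\mathbb{N}}$ in which no string is a suffix of another string; it is unbounded if $\sup\{|v|:v\in\tau\}=+\infty$; it is complete (a context tree) if every $a_{-\infty}^{-1}\in A^{-\mathbb{N}}$ has a (necessarily unique) suffix in $\tau$, called its context $c_\tau(a_{-\infty}^{-1})$. For a finite string $a_m^n$, $c_\tau(a_m^n)$ is its suffix belonging to $\tau$ if there is one, and $c_\tau(a_m^n)=\emptyset$ otherwise. A probabilistic context tree $(\tau,p)$ is a context tree $\tau$ with a family $p=\{p(\cdot|v):v\in\tau\}$ of probability distributions on $A$. A stochastic chain $(X_n)_{n\in\mathbb{Z}}$ of law $\mathbb{P}$ is compatible with $(\tau,p)$ if for $\mathbb{P}$-a.e. past $a_{-\infty}^{-1}$ and every $a\in A$, $\mathbb{P}(X_0=a|X_{-\infty}^{-1}=a_{-\infty}^{-1})=p(a|c_\tau(a_{-\infty}^{-1}))$. $\epsilon$-regularity: $a\in A$ is $\epsilon$-regular if $\inf_{v\in\tau}p(a|v)\ge\epsilon$;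 a finite string is $\epsilon$-regular if all symbols appearing in it are. $\mathcal{E}$ is the (finite) set of $\epsilon$-regular symbols, and $\#\mathcal{E}$ its cardinality. Symbols are labelled so that $A=\{1,2,\ldots\}$ and $\mathcal{E}=\{1,\ldots,\#\mathcal{E}\}$. Reference string: for a nonempty finite string $w$ and $v\in\tau$ let $m^w(v)=\inf\{j:0\le j\le|v|-|w|,\ v_{-j-|w|}^{-j-1}=w\}$, with $m^w(v)=+\infty$ if there is no such $j$. $w$ is a reference string of $\tau$ with function $\ell^w:\mathbb{N}\to\mathbb{N}$ (finite valued) if $|v|=m^w(v)+|w|+\ell^w(m^w(v))$ for every $v\in\tau$ (so $|v|=+\infty$ exactly when $m^w(v)=+\infty$). Convention: $\log 0=-\infty$. Construction: for $v\in\tau$ and $a\in\mathcal{E}$ let $J(a|\emptyset)=[(a-1)\epsilon,a\epsilon[$, $J(a|v)=\bigl[\#\mathcal{E}\epsilon+\sum_{i=1}^{a-1}(p(i|v)-\epsilon),\ \#\mathcal{E}\epsilon+\sum_{i=1}^{a}(p(i|v)-\epsilon)\bigr[$ and $K(a|v)=J(a|\emptyset)\cup J(a|v)$; for $a\in A\setminus\mathcal{E}$ let $K(a|v)=J(a|v)=\bigl[\sum_{i=1}^{a-1}p(i|v),\sum_{i=1}^{a}p(i|v)\bigr[$. Let $\mathbf{U}=(U_n)_{n\in\mathbb{Z}}$ be i.i.d. uniform on $[0,1[$ under $\mathbb{P}$. The update function $F(u,s)\in A\cup\{\star\}$, for $u\in[0,1[$ and a string $s$ (finite or infinite), is: if $c_\tau(s)\ne\emptyset$,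 $F(u,s)=a$ for the unique $a\in A$ with $u\in K(a|c_\tau(s))$; if $c_\tau(s)=\emptyset$, $F(u,s)=a$ when $u\in J(a|\emptyset)$, $a\in\mathcal{E}$, and $F(u,s)=\star$ when $u\in[\#\mathcal{E}\epsilon,1[$. For $m\le n\le+\infty$, $\mathcal{L}(U_m^n)\in\{0,1\}$ equals $1$ if and only if there is a string $a_m^n$ of symbols of $A$ with $F(U_i,a_m^{i-1})=a_i$ for all $i$ with $m\le i\le n$ ($i<\infty$). Put $\theta[m,n]:=\max\{k\le m:\mathcal{L}(U_k^n)=1\}$ (equal to $-\infty$ if there is no such $k$). Under the hypotheses of the claim, $\theta[m,n]>-\infty$ almost surely for all $m\le n\le+\infty$. Output of the algorithm and the chain $X(\mathbf{U})$: with $k=\theta[m,n]$, the algorithm for the window $[m,n]$ outputs the string $([X(\mathbf{U})]_k,\ldots,[X(\mathbf{U})]_n)$ defined recursively by $[X(\mathbf{U})]_i=F(U_i,[X(\mathbf{U})]_k^{i-1})$, $i=k,\ldots,n$. Values computed for different windows agree wherever they are both defined, so this defines almost surely a chain $X(\mathbf{U})=([X(\mathbf{U})]_n)_{n\in\mathbb{Z}}$ with values in $A$. *)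

theory Defs
  imports "HOL-Probability.Probability"
begin

section \<open>Strings and context trees\<close>

text \<open>
  \<open>Str xs\<close> is the finite string whose letters, in order of time, are \<open>xs\<close>, so that the last
  element of \<open>xs\<close> sits at position \<open>-1\<close>.  \<open>Past x\<close> is an infinite past, and
  \<open>x i\<close> is its letter at position \<open>-(i + 1)\<close>.
\<close>

datatype 'a pstring = Str "'a list" | Past "nat \<Rightarrow> 'a"

fun len :: "'a pstring \<Rightarrow> enat" where
  "len (Str xs) = enat (length xs)"
| "len (Past x) = \<infinity>"

text \<open>The letter at position \<open>-(i + 1)\<close>; only meaningful for \<open>enat i < len s\<close>.\<close>

fun letter :: "'a pstring \<Rightarrow> nat \<Rightarrow> 'a" where
  "letter (Str xs) i = rev xs ! i"
| "letter (Past x) i = x i"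

fun letters :: "'a pstring \<Rightarrow> 'a set" where
  "letters (Str xs) = set xs"
| "letters (Past x) = range x"

definition suffix_of :: "'a pstring \<Rightarrow> 'a pstring \<Rightarrow> bool" where
  "suffix_of s v \<longleftrightarrow> len s \<le> len v \<and> (\<forall>i. enat i < len s \<longrightarrow> letter v i = letter s i)"

definition is_tree :: "'a set \<Rightarrow> 'a pstring set \<Rightarrow> bool" where
  "is_tree A \<tau> \<longleftrightarrow>
     (\<forall>v\<in>\<tau>. letters v \<subseteq> A) \<and> (\<forall>s\<in>\<tau>. \<forall>v\<in>\<tau>. s \<noteq> v \<longrightarrow> \<not> suffix_of s v)"

definition unbounded :: "'a pstring set \<Rightarrow> bool" where
  "unbounded \<tau> \<longleftrightarrow> (SUP v\<in>\<tau>. len v) = \<infinity>"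

definition context_tree :: "'a set \<Rightarrow> 'a pstring set \<Rightarrow> bool" where
  "context_tree A \<tau> \<longleftrightarrow>
     is_tree A \<tau> \<and> (\<forall>x. range x \<subseteq> A \<longrightarrow> (\<exists>v\<in>\<tau>. suffix_of v (Past x)))"

definition ctx :: "'a pstring set \<Rightarrow> 'a pstring \<Rightarrow> 'a pstring" where
  "ctx \<tau> s = (if \<exists>v\<in>\<tau>. suffix_of v s then THE v. v \<in> \<tau> \<and> suffix_of v s else Str [])"

text \<open>\<open>pmf (p v) a\<close> stands for $p(a|v)$.  The values of \<open>p\<close> outside \<open>\<tau>\<close> play no role.\<close>

definition prob_context_tree ::
    "'a set \<Rightarrow> 'a pstring set \<Rightarrow> ('a pstring \<Rightarrow> 'a pmf) \<Rightarrow> bool" where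
  "prob_context_tree A \<tau> p \<longleftrightarrow> context_tree A \<tau> \<and> (\<forall>v\<in>\<tau>. set_pmf (p v) \<subseteq> A)"

text \<open>A countable alphabet, finite or infinite, labelled by the positive integers.\<close>

definition alphabet :: "nat set \<Rightarrow> bool" where
  "alphabet A \<longleftrightarrow> A = {1..} \<or> (\<exists>N\<ge>1. A = {1..N})"

definition regular_symbols ::
    "'a set \<Rightarrow> 'a pstring set \<Rightarrow> ('a pstring \<Rightarrow> 'a pmf) \<Rightarrow> real \<Rightarrow> 'a set" where
  "regular_symbols A \<tau> p \<epsilon> = {a \<in> A. (INF v\<in>\<tau>. pmf (p v) a) \<ge> \<epsilon>}"

definition regular_string ::
    "'a set \<Rightarrow> 'a pstring set \<Rightarrow> ('a pstring \<Rightarrow> 'a pmf) \<Rightarrow> real \<Rightarrow> 'a list \<Rightarrow> bool" where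
  "regular_string A \<tau> p \<epsilon> s \<longleftrightarrow> set s \<subseteq> regular_symbols A \<tau> p \<epsilon>"


section \<open>Reference strings\<close>

text \<open>
  The value is \<open>\<infinity>\<close> if \<open>w\<close> does not occur in \<open>v\<close>.  The condition $j \le |v| - |w|$ is
  written additively because subtraction on \<open>enat\<close> truncates.
\<close>

definition first_occ :: "'a list \<Rightarrow> 'a pstring \<Rightarrow> enat" where
  "first_occ w v = Inf {enat j | j. enat (j + length w) \<le> len v \<and>
                                    (\<forall>i<length w. letter v (j + i) = rev w ! i)}"

definition reference_string :: "'a pstring set \<Rightarrow> 'a list \<Rightarrow> (nat \<Rightarrow> nat) \<Rightarrow> bool" where
  "reference_string \<tau> w ell \<longleftrightarrow> w \<noteq> [] \<and>
     (\<forall>v\<in>\<tau>. len v = (case first_occ w v of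
                       enat j \<Rightarrow> enat (j + length w + ell j)
                     | \<infinity> \<Rightarrow> \<infinity>))"

definition log_nat :: "nat \<Rightarrow> ereal" where
  "log_nat k = (if k = 0 then -\<infinity> else ereal (ln (real k)))"

definition C_const :: "real \<Rightarrow> 'a list \<Rightarrow> real" where
  "C_const \<epsilon> w = - (1 / real (length w)) * ln (1 - \<epsilon> ^ length w)"


section \<open>Laws of stationary chains compatible with a tree\<close>

definition path_space :: "'a set \<Rightarrow> (int \<Rightarrow> 'a) measure" where
  "path_space A = (\<Pi>\<^sub>M n\<in>UNIV. count_space A)"

definition string_space :: "'a set \<Rightarrow> int \<Rightarrow> int \<Rightarrow> (int \<Rightarrow> 'a) measure" where
  "string_space A m n = (\<Pi>\<^sub>M i\<in>{m..n}. count_space A)"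

definition chain_law :: "'a set \<Rightarrow> 'w measure \<Rightarrow> (int \<Rightarrow> 'w \<Rightarrow> 'a) \<Rightarrow> (int \<Rightarrow> 'a) measure" where
  "chain_law A M X = distr M (path_space A) (\<lambda>\<omega> n. X n \<omega>)"

definition marginal :: "'a set \<Rightarrow> int \<Rightarrow> int \<Rightarrow> (int \<Rightarrow> 'a) measure \<Rightarrow> (int \<Rightarrow> 'a) measure" where
  "marginal A m n \<mu> = distr \<mu> (string_space A m n) (\<lambda>x. restrict x {m..n})"

definition stationary_law :: "'a set \<Rightarrow> (int \<Rightarrow> 'a) measure \<Rightarrow> bool" where
  "stationary_law A \<mu> \<longleftrightarrow> prob_space \<mu> \<and> sets \<mu> = sets (path_space A) \<and>
     (\<forall>k. distr \<mu> (path_space A) (\<lambda>x n. x (n + k)) = \<mu>)"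

definition past :: "(int \<Rightarrow> 'a) \<Rightarrow> nat \<Rightarrow> 'a" where
  "past x i = x (- 1 - int i)"

definition past_algebra :: "'a set \<Rightarrow> (int \<Rightarrow> 'a) measure" where
  "past_algebra A = vimage_algebra (space (path_space A)) past (\<Pi>\<^sub>M i\<in>UNIV. count_space A)"

text \<open>
  A version of the conditional probability of $X_0 = a$ given the past is the conditional
  expectation of the corresponding indicator with respect to the sigma-algebra of the past.
\<close>

definition compatible_law ::
    "'a set \<Rightarrow> 'a pstring set \<Rightarrow> ('a pstring \<Rightarrow> 'a pmf) \<Rightarrow> (int \<Rightarrow> 'a) measure \<Rightarrow> bool" where
  "compatible_law A \<tau> p \<mu> \<longleftrightarrow>
     (AE x in \<mu>. \<forall>a\<in>A.
        real_cond_exp \<mu> (past_algebra A) (indicator {y. y 0 = a}) x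
          = pmf (p (ctx \<tau> (Past (past x)))) a)"


section \<open>The perfect simulation algorithm\<close>

text \<open>Here and below the regular symbols are supposed to be $1, \ldots, \#\mathcal{E}$.\<close>

definition J_empty :: "real \<Rightarrow> nat \<Rightarrow> real set" where
  "J_empty \<epsilon> a = {(real a - 1) * \<epsilon> ..< real a * \<epsilon>}"

definition J_set ::
    "nat set \<Rightarrow> nat pstring set \<Rightarrow> (nat pstring \<Rightarrow> nat pmf) \<Rightarrow> real \<Rightarrow> nat \<Rightarrow> nat pstring \<Rightarrow> real set"
where
  "J_set A \<tau> p \<epsilon> a v =
     (let E = regular_symbols A \<tau> p \<epsilon> in
      if a \<in> E
      then {real (card E) * \<epsilon> + (\<Sum>i=1..a - 1. pmf (p v) i - \<epsilon>) ..<
            real (card E) * \<epsilon> + (\<Sum>i=1..a. pmf (p v) i - \<epsilon>)}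
      else {(\<Sum>i=1..a - 1. pmf (p v) i) ..< (\<Sum>i=1..a. pmf (p v) i)})"

definition K_set ::
    "nat set \<Rightarrow> nat pstring set \<Rightarrow> (nat pstring \<Rightarrow> nat pmf) \<Rightarrow> real \<Rightarrow> nat \<Rightarrow> nat pstring \<Rightarrow> real set"
where
  "K_set A \<tau> p \<epsilon> a v =
     (if a \<in> regular_symbols A \<tau> p \<epsilon> then J_empty \<epsilon> a \<union> J_set A \<tau> p \<epsilon> a v else J_set A \<tau> p \<epsilon> a v)"

text \<open>The update function $F$, with \<open>None\<close> in the role of $\star$.\<close>

definition update ::
    "nat set \<Rightarrow> nat pstring set \<Rightarrow> (nat pstring \<Rightarrow> nat pmf) \<Rightarrow> real \<Rightarrow> real \<Rightarrow> nat pstring \<Rightarrow> nat option"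
where
  "update A \<tau> p \<epsilon> u s =
     (if ctx \<tau> s \<noteq> Str [] then Some (THE a. a \<in> A \<and> u \<in> K_set A \<tau> p \<epsilon> a (ctx \<tau> s))
      else if \<exists>a\<in>regular_symbols A \<tau> p \<epsilon>. u \<in> J_empty \<epsilon> a
      then Some (THE a. a \<in> regular_symbols A \<tau> p \<epsilon> \<and> u \<in> J_empty \<epsilon> a)
      else None)"

text \<open>The event $\mathcal{L}(u_m^n) = 1$; the list \<open>map a [m..i - 1]\<close> is the string $a_m^{i-1}$.\<close>

definition constructible ::
    "nat set \<Rightarrow> nat pstring set \<Rightarrow> (nat pstring \<Rightarrow> nat pmf) \<Rightarrow> real \<Rightarrow> (int \<Rightarrow> real) \<Rightarrow> int \<Rightarrow> int \<Rightarrow> bool"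
where
  "constructible A \<tau> p \<epsilon> u m n \<longleftrightarrow>
     (\<exists>a. \<forall>i\<in>{m..n}. a i \<in> A \<and> update A \<tau> p \<epsilon> (u i) (Str (map a [m..i - 1])) = Some (a i))"

text \<open>The starting time $\theta[m,n]$, with \<open>None\<close> in the role of $-\infty$.\<close>

definition start_time ::
    "nat set \<Rightarrow> nat pstring set \<Rightarrow> (nat pstring \<Rightarrow> nat pmf) \<Rightarrow> real \<Rightarrow>
     (int \<Rightarrow> real) \<Rightarrow> int \<Rightarrow> int \<Rightarrow> int option"
where
  "start_time A \<tau> p \<epsilon> u m n =
     (if \<exists>k\<le>m. constructible A \<tau> p \<epsilon> u k n
      then Some (GREATEST k. k \<le> m \<and> constructible A \<tau> p \<epsilon> u k n) else None)"

function run ::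
    "nat set \<Rightarrow> nat pstring set \<Rightarrow> (nat pstring \<Rightarrow> nat pmf) \<Rightarrow> real \<Rightarrow> (int \<Rightarrow> real) \<Rightarrow> int \<Rightarrow> int \<Rightarrow> nat"
where
  "run A \<tau> p \<epsilon> u k i = the (update A \<tau> p \<epsilon> (u i) (Str (map (run A \<tau> p \<epsilon> u k) [k..i - 1])))"
  by pat_completeness auto
termination
  by (relation "Wellfounded.measure (\<lambda>(A, \<tau>, p, \<epsilon>, u, k, i). nat (i - k))") auto

declare run.simps [simp del]

text \<open>
  Letter \<open>i\<close> of the output for the window \<open>[m, n]\<close>.  If the algorithm does not terminate, the
  symbol \<open>1\<close> is returned, merely to obtain an everywhere defined \<open>A\<close>-valued variable.
\<close>

definition window_output ::
    "nat set \<Rightarrow> nat pstring set \<Rightarrow> (nat pstring \<Rightarrow> nat pmf) \<Rightarrow> real \<Rightarrow>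
     (int \<Rightarrow> real) \<Rightarrow> int \<Rightarrow> int \<Rightarrow> int \<Rightarrow> nat"
where
  "window_output A \<tau> p \<epsilon> u m n i =
     (case start_time A \<tau> p \<epsilon> u m n of Some k \<Rightarrow> run A \<tau> p \<epsilon> u k i | None \<Rightarrow> 1)"

text \<open>
  The chain $X(\mathbf{u})$, read off from the windows consisting of a single time; any
  other window containing \<open>n\<close> on which the algorithm terminates yields the same letter at \<open>n\<close>.
\<close>

definition X_chain ::
    "nat set \<Rightarrow> nat pstring set \<Rightarrow> (nat pstring \<Rightarrow> nat pmf) \<Rightarrow> real \<Rightarrow> (int \<Rightarrow> real) \<Rightarrow> int \<Rightarrow> nat"
where
  "X_chain A \<tau> p \<epsilon> u n = window_output A \<tau> p \<epsilon> u n n n"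

definition iid_uniform :: "'w measure \<Rightarrow> (int \<Rightarrow> 'w \<Rightarrow> real) \<Rightarrow> bool" where
  "iid_uniform M U \<longleftrightarrow> prob_space M \<and>
     prob_space.indep_vars M (\<lambda>_. borel) U UNIV \<and>
     (\<forall>n. distr M borel (U n) = uniform_measure lborel {0..<1})"

end

theory Submission
  imports Defs "HOL-Real_Asymp.Real_Asymp"
begin

text \<open>
  The engine is coherence (\<open>update_suffix\<close>): for a regular symbol \<open>a\<close> the interval
  \<open>J_empty \<epsilon> a\<close> is contained in every \<open>K a v\<close>, so a symbol computed from a finite string is also the symbol computed from any longer
  string, in particular from the whole past.  Runs started at different times therefore agree
  wherever they do not stop, and the constructed letters satisfy the recursion
  \<open>X i = F(U i, past of X before i)\<close>.

  Termination (\<open>AE_regular_path\<close>).  Cut time into blocks of length \<open>|w|\<close>.  With probability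
  \<open>q = \<epsilon> ^ |w|\<close>, independently for different blocks, the uniform variables of a block force the
  letters of \<open>w\<close>.  If \<open>w\<close> has occurred \<open>m\<close> symbols ago, the context is visible in a string of
  length \<open>|w| + m + ell m\<close>; as \<open>ell m\<close> is at most of order \<open>exp (c C m)\<close> with \<open>c < 1\<close>, a run of
  length \<open>n\<close> stops only if the last \<open>ln n / (c C)\<close> symbols, roughly, contain no such block.  The
  choice of \<open>C\<close> makes this an event of probability of order \<open>n powr (- 1 / c)\<close>, which is summable.
  Hence a run that begins with enough copies of \<open>w\<close> goes on for ever with positive probability,
  and comparing many starting times far apart from each other shows that, almost surely, such runs
  start arbitrarily far back.

  Existence.  The chain is a shift-equivariant function of the uniform variables, hence stationary.
  Its letter at time \<open>0\<close> is obtained from its past and the independent variable \<open>U 0\<close>, which hits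
  \<open>K a v\<close> with probability \<open>p(a|v)\<close>; since \<open>w\<close> almost surely occurs in the past, only countably
  many contexts have to be considered (\<open>compatible_law_law\<close>).

  Uniqueness (\<open>compatible_unique\<close>).  Let the algorithm start at a remote time with no memory, and
  let it forget its string whenever it stops.  Given a past ending with the remembered string, a
  stationary compatible chain chooses \<open>a\<close> with at least the probability that the algorithm does.
  By induction on the number of steps, the chain gives any event on a window at least the
  probability that the restarting algorithm knows all letters of the window and they lie in the
  event.  As the starting time tends to minus infinity the latter tends to the probability under the
  constructed law, so the constructed law is dominated on every window event; applied to an
  event and to its complement, this is equality.
\<close>

section \<open>Suffixes and contexts\<close>

lemma suffix_of_Str_Str:
  "suffix_of (Str s) (Str t) \<longleftrightarrow> (\<exists>r. t = r @ s)"
proof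
  assume *: "suffix_of (Str s) (Str t)"
  then have le: "length s \<le> length t" and eq: "\<And>i. i < length s \<Longrightarrow> rev t ! i = rev s ! i"
    by (auto simp: suffix_of_def)
  have "take (length s) (rev t) = rev s"
    using le eq by (intro nth_equalityI) auto
  then have "rev t = rev s @ drop (length s) (rev t)"
    by (metis append_take_drop_id)
  then have "t = rev (drop (length s) (rev t)) @ s"
    by (metis rev_append rev_rev_ident)
  then show "\<exists>r. t = r @ s" by blast
next
  assume "\<exists>r. t = r @ s"
  then show "suffix_of (Str s) (Str t)"
    by (auto simp: suffix_of_def nth_append)
qed

lemma suffix_of_Str_Past:
  "suffix_of (Str t) (Past x) \<longleftrightarrow> (\<forall>i<length t. x i = rev t ! i)"
  by (simp add: suffix_of_def)

lemma suffix_of_Past: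
  assumes "suffix_of (Past x) s"
  shows "s = Past x"
  using assms by (cases s) (auto simp: suffix_of_def)

lemma suffix_of_Nil: "suffix_of (Str []) s"
  by (simp add: suffix_of_def zero_enat_def[symmetric])

lemma suffix_of_trans:
  assumes "suffix_of a b" "suffix_of b c"
  shows "suffix_of a c"
  using assms unfolding suffix_of_def by (auto intro: order_trans dest: order_less_le_trans)

lemma suffix_of_linear:
  assumes "suffix_of s x" "suffix_of v x" "len s \<le> len v"
  shows "suffix_of s v"
  using assms unfolding suffix_of_def by (auto dest: order_less_le_trans)

text \<open>Two suffixes of one string are comparable, so a tree contains at most one of them.\<close>

lemma ctx_eqI:
  assumes "is_tree A \<tau>" "v \<in> \<tau>" "suffix_of v s"
  shows "ctx \<tau> s = v"
proof -
  have "v' = v" if v': "v' \<in> \<tau>" "suffix_of v' s" for v'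
  proof -
    have "suffix_of v v' \<or> suffix_of v' v"
      using suffix_of_linear[OF v'(2) assms(3)] suffix_of_linear[OF assms(3) v'(2)]
        linear[of "len v" "len v'"] by argo
    then show ?thesis using assms(1,2) v'(1) unfolding is_tree_def by metis
  qed
  then have "(THE v. v \<in> \<tau> \<and> suffix_of v s) = v"
    using assms(2,3) by (intro the_equality) blast+
  moreover have "\<exists>v\<in>\<tau>. suffix_of v s" using assms(2,3) by blast
  ultimately show ?thesis by (simp only: ctx_def if_True)
qed

lemma ctx_nonempty:
  assumes "is_tree A \<tau>" "ctx \<tau> s \<noteq> Str []"
  shows "ctx \<tau> s \<in> \<tau>" "suffix_of (ctx \<tau> s) s"
proof -
  obtain v where "v \<in> \<tau>" "suffix_of v s"
    using assms(2) unfolding ctx_def by metis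
  then show "ctx \<tau> s \<in> \<tau>" "suffix_of (ctx \<tau> s) s"
    unfolding ctx_eqI[OF assms(1) \<open>v \<in> \<tau>\<close> \<open>suffix_of v s\<close>] .
qed

section \<open>The update function\<close>

locale regular_context_tree =
  fixes A :: "nat set" and \<tau> :: "nat pstring set" and p :: "nat pstring \<Rightarrow> nat pmf" and \<epsilon> :: real
  assumes alphabet: "alphabet A"
    and prob_tree: "prob_context_tree A \<tau> p"
    and no_empty: "Str [] \<notin> \<tau>"
    and eps_pos: "0 < \<epsilon>"
    and regular_eq: "regular_symbols A \<tau> p \<epsilon> = {1..card (regular_symbols A \<tau> p \<epsilon>)}"
begin

abbreviation "E \<equiv> regular_symbols A \<tau> p \<epsilon>"
abbreviation "e \<equiv> card E"
abbreviation "K \<equiv> K_set A \<tau> p \<epsilon>"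
abbreviation "J \<equiv> J_set A \<tau> p \<epsilon>"
abbreviation "upd \<equiv> update A \<tau> p \<epsilon>"

lemma tree: "is_tree A \<tau>"
  using prob_tree by (simp add: prob_context_tree_def context_tree_def)

lemma ctx_Past:
  assumes "range x \<subseteq> A"
  shows "ctx \<tau> (Past x) \<in> \<tau>" "suffix_of (ctx \<tau> (Past x)) (Past x)" "ctx \<tau> (Past x) \<noteq> Str []"
proof -
  obtain v where v: "v \<in> \<tau>" "suffix_of v (Past x)"
    using prob_tree assms unfolding prob_context_tree_def context_tree_def by blast
  then show "ctx \<tau> (Past x) \<in> \<tau>" "suffix_of (ctx \<tau> (Past x)) (Past x)" "ctx \<tau> (Past x) \<noteq> Str []"
    unfolding ctx_eqI[OF tree v] using no_empty by metis+
qed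

lemma one_in_alphabet: "1 \<in> A"
  using alphabet by (auto simp: alphabet_def)

lemma alphabet_pos: "a \<in> A \<Longrightarrow> 1 \<le> a"
  using alphabet by (auto simp: alphabet_def)

lemma pmf_outside: "v \<in> \<tau> \<Longrightarrow> a \<notin> A \<Longrightarrow> pmf (p v) a = 0"
  using prob_tree unfolding prob_context_tree_def pmf_eq_0_set_pmf by blast

lemma mem_E: "a \<in> E \<longleftrightarrow> 1 \<le> a \<and> a \<le> e"
  using regular_eq by (metis atLeastAtMost_iff)

lemma E_subset: "a \<in> E \<Longrightarrow> a \<in> A"
  by (simp add: regular_symbols_def)

lemma regular_lower:
  assumes "a \<in> E" "v \<in> \<tau>"
  shows "\<epsilon> \<le> pmf (p v) a"
proof -
  have "(INF v\<in>\<tau>. pmf (p v) a) \<le> pmf (p v) a"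
    using assms(2) by (intro cINF_lower) (auto intro!: bdd_belowI[of _ 0])
  then show ?thesis using assms(1) by (simp add: regular_symbols_def)
qed

text \<open>
  The right endpoint of \<open>J a v\<close>, in one formula for regular and for other symbols: after
  the first \<open>e \<epsilon>\<close> units of length have been given to the intervals \<open>J_empty\<close>, the
  symbols up to \<open>a\<close> still need their probabilities, minus \<open>\<epsilon>\<close> for the regular ones.
\<close>

definition endpoint :: "nat pstring \<Rightarrow> nat \<Rightarrow> real" where
  "endpoint v a = (\<Sum>i=1..a. pmf (p v) i) + real (e - a) * \<epsilon>"

lemma endpoint_0: "endpoint v 0 = real e * \<epsilon>"
  by (simp add: endpoint_def)

lemma endpoint_Suc:
  "endpoint v (Suc a) = endpoint v a + pmf (p v) (Suc a) - (if Suc a \<in> E then \<epsilon> else 0)"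
proof (cases "a < e")
  case True
  then have "real (e - a) = real (e - Suc a) + 1" by linarith
  with True show ?thesis by (auto simp: endpoint_def mem_E algebra_simps)
next
  case False
  then show ?thesis by (auto simp: endpoint_def mem_E)
qed

lemma endpoint_mono:
  assumes "v \<in> \<tau>"
  shows "mono (endpoint v)"
  by (rule mono_iff_le_Suc[THEN iffD2]) (use regular_lower[OF _ assms] in \<open>auto simp: endpoint_Suc\<close>)


lemma J_eq:
  assumes "a \<in> A"
  shows "J a v = {endpoint v (a - 1) ..< endpoint v a}"
proof -
  obtain b where b: "a = Suc b" using alphabet_pos[OF assms] by (cases a) auto
  have *: "real e * \<epsilon> + (\<Sum>i=1..c. pmf (p v) i - \<epsilon>) = endpoint v c" if "c \<le> e" for c
    using that by (simp add: endpoint_def sum_subtractf of_nat_diff algebra_simps)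
  show ?thesis
  proof (cases "a \<in> E")
    case True
    then show ?thesis using *[of a] *[of "a - 1"] by (auto simp: J_set_def mem_E)
  next
    case False
    then have "e \<le> b" using b by (auto simp: mem_E)
    then show ?thesis using False b by (simp add: J_set_def endpoint_def)
  qed
qed

lemma J_empty_unique:
  assumes "u \<in> J_empty \<epsilon> a" "u \<in> J_empty \<epsilon> b"
  shows "a = b"
proof -
  have "(real a - 1) * \<epsilon> < real b * \<epsilon>" "(real b - 1) * \<epsilon> < real a * \<epsilon>"
    using assms by (auto simp: J_empty_def)
  then have "real a - 1 < real b" "real b - 1 < real a"
    using eps_pos by (auto simp: mult_less_cancel_right)
  then show ?thesis by linarith
qed

lemma J_empty_range:
  assumes "u \<in> J_empty \<epsilon> a" "a \<in> E"
  shows "0 \<le> u" "u < real e * \<epsilon>"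
proof -
  have *: "1 \<le> a" "a \<le> e" using assms(2) by (auto simp: mem_E)
  have "0 \<le> (real a - 1) * \<epsilon>" using * eps_pos by auto
  then show "0 \<le> u" using assms by (auto simp: J_empty_def)
  have "real a * \<epsilon> \<le> real e * \<epsilon>" using * eps_pos by auto
  then show "u < real e * \<epsilon>" using assms by (auto simp: J_empty_def)
qed

lemma J_empty_cover:
  assumes "0 \<le> u" "u < real e * \<epsilon>"
  shows "\<exists>a\<in>E. u \<in> J_empty \<epsilon> a"
proof -
  define a where "a = nat \<lfloor>u / \<epsilon>\<rfloor> + 1"
  have "0 \<le> u / \<epsilon>" using assms eps_pos by simp
  then have r: "real a = of_int \<lfloor>u / \<epsilon>\<rfloor> + 1" by (simp add: a_def)
  have 1: "real a - 1 \<le> u / \<epsilon>" "u / \<epsilon> < real a" unfolding r by linarith+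
  have "u / \<epsilon> < real e" using assms eps_pos by (simp add: divide_simps)
  then have "a \<in> E" using 1 by (auto simp: mem_E a_def)
  moreover have "u \<in> J_empty \<epsilon> a" using 1 eps_pos by (simp add: J_empty_def field_simps)
  ultimately show ?thesis by blast
qed

lemma pmf_0: "v \<in> \<tau> \<Longrightarrow> pmf (p v) 0 = 0"
  using pmf_outside alphabet_pos by force

lemma endpoint_lim:
  assumes "v \<in> \<tau>"
  shows "endpoint v \<longlonglongrightarrow> 1"
proof -
  have "(\<lambda>a. measure (p v) {..a}) \<longlonglongrightarrow> measure (p v) (\<Union>a. {..a})"
    by (rule measure_pmf.finite_Lim_measure_incseq) (auto simp: incseq_def)
  moreover have "(\<Union>a::nat. {..a}) = UNIV" by auto
  ultimately have lim: "(\<lambda>a. measure (p v) {..a}) \<longlonglongrightarrow> 1" by simp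
  have "measure (p v) {..a} = endpoint v a" if "e \<le> a" for a
    using that pmf_0[OF assms]
    by (simp add: measure_measure_pmf_finite atMost_atLeast0 sum.atLeast_Suc_atMost endpoint_def)
  then have "\<forall>\<^sub>F a in sequentially. measure (p v) {..a} = endpoint v a"
    unfolding eventually_sequentially by blast
  with lim show ?thesis by (rule Lim_transform_eventually)
qed

lemma endpoint_bounds:
  assumes "v \<in> \<tau>"
  shows "real e * \<epsilon> \<le> endpoint v a" "endpoint v a \<le> 1"
  using monoD[OF endpoint_mono[OF assms], of 0 a] endpoint_0
    incseq_le[OF endpoint_mono[OF assms] endpoint_lim[OF assms]] by auto

lemma J_range:
  assumes "v \<in> \<tau>" "a \<in> A" "u \<in> J a v"
  shows "real e * \<epsilon> \<le> u" "u < 1"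
  using assms endpoint_bounds[OF assms(1)] by (auto simp: J_eq intro: order_trans order_less_le_trans)

lemma J_unique:
  assumes "v \<in> \<tau>" "a \<in> A" "b \<in> A" "u \<in> J a v" "u \<in> J b v"
  shows "a = b"
proof -
  have F: False if "a < b" "a \<in> A" "b \<in> A" "u \<in> J a v" "u \<in> J b v" for a b
  proof -
    have "endpoint v a \<le> endpoint v (b - 1)"
      using monoD[OF endpoint_mono[OF assms(1)], of a "b - 1"] that(1) by simp
    then show False using that by (auto simp: J_eq)
  qed
  show ?thesis using F[of a b] F[of b a] assms linorder_neqE_nat by blast
qed

lemma J_cover:
  assumes "v \<in> \<tau>" "real e * \<epsilon> \<le> u" "u < 1"
  shows "\<exists>a\<in>A. u \<in> J a v"
proof -
  have "\<exists>a. u < endpoint v a"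
    using order_tendstoD(1)[OF endpoint_lim[OF assms(1)] assms(3)]
    by (auto simp: eventually_sequentially)
  define a where "a = (LEAST a. u < endpoint v a)"
  have 1: "u < endpoint v a" unfolding a_def by (rule LeastI_ex) fact
  with assms endpoint_0 have "a \<noteq> 0" by (intro notI) simp
  then obtain b where b: "a = Suc b" by (cases a) auto
  have 2: "endpoint v b \<le> u" using not_less_Least[of b "\<lambda>a. u < endpoint v a"] b
    by (simp add: a_def)
  \<comment> \<open>the interval of a symbol outside \<open>A\<close> would be empty\<close>
  have "a \<in> A"
  proof (rule ccontr)
    assume "a \<notin> A"
    with 1 2 pmf_outside[OF assms(1) this] eps_pos show False
      unfolding b endpoint_Suc by (auto split: if_splits)
  qed
  moreover from this have "u \<in> J a v" using 1 2 b by (simp add: J_eq)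
  ultimately show ?thesis by blast
qed

text \<open>
  The sets \<open>K a v\<close> partition the unit interval because the intervals \<open>J_empty\<close> of the regular
  symbols fill its part below \<open>e \<epsilon>\<close> and the intervals \<open>J a v\<close> fill the rest.
\<close>

lemma K_range:
  assumes "v \<in> \<tau>" "a \<in> A" "u \<in> K a v"
  shows "0 \<le> u" "u < 1"
proof -
  have "real e * \<epsilon> \<le> 1" "0 \<le> real e * \<epsilon>"
    using endpoint_bounds[OF assms(1), of 0] endpoint_0 eps_pos by auto
  then show "0 \<le> u" "u < 1"
    using assms J_range[OF assms(1,2), of u] J_empty_range[of u a] by (auto simp: K_set_def split: if_splits)
qed

lemma K_unique:
  assumes "v \<in> \<tau>" "a \<in> A" "b \<in> A" "u \<in> K a v" "u \<in> K b v"
  shows "a = b"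
  using assms J_unique[OF assms(1-3)] J_empty_unique[of u a b] J_range[OF assms(1,2), of u]
    J_range[OF assms(1,3), of u] J_empty_range[of u a] J_empty_range[of u b]
  by (auto simp: K_set_def split: if_splits)

lemma K_cover:
  assumes "v \<in> \<tau>" "0 \<le> u" "u < 1"
  shows "\<exists>a\<in>A. u \<in> K a v"
  using J_cover[OF assms(1), of u] J_empty_cover[of u] assms E_subset
  by (cases "u < real e * \<epsilon>") (auto simp: K_set_def)

lemma update_ctx:
  assumes "ctx \<tau> s \<noteq> Str []" "0 \<le> u" "u < 1"
  shows "upd u s = Some a \<longleftrightarrow> a \<in> A \<and> u \<in> K a (ctx \<tau> s)" "upd u s \<noteq> None"
proof -
  have v: "ctx \<tau> s \<in> \<tau>" using ctx_nonempty[OF tree assms(1)] by simp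
  obtain b where b: "b \<in> A" "u \<in> K b (ctx \<tau> s)" using K_cover[OF v assms(2,3)] by blast
  have "(THE a. a \<in> A \<and> u \<in> K a (ctx \<tau> s)) = b"
    using b K_unique[OF v] by (intro the_equality) auto
  then show "upd u s = Some a \<longleftrightarrow> a \<in> A \<and> u \<in> K a (ctx \<tau> s)" "upd u s \<noteq> None"
    using assms b K_unique[OF v] by (auto simp: update_def)
qed

lemma update_no_ctx:
  assumes "ctx \<tau> s = Str []"
  shows "upd u s = Some a \<longleftrightarrow> a \<in> E \<and> u \<in> J_empty \<epsilon> a"
proof -
  have "(THE a. a \<in> E \<and> u \<in> J_empty \<epsilon> a) = b" if "b \<in> E" "u \<in> J_empty \<epsilon> b" for b
    using that J_empty_unique by (intro the_equality) auto
  then show ?thesis using assms by (auto simp: update_def)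
qed

lemma update_in_alphabet:
  assumes "upd u s = Some a" "0 \<le> u" "u < 1"
  shows "a \<in> A"
  using assms update_ctx[OF _ assms(2,3)] update_no_ctx E_subset by (cases "ctx \<tau> s = Str []") auto

lemma update_regular:
  assumes "u \<in> J_empty \<epsilon> a" "a \<in> E" "0 \<le> u" "u < 1"
  shows "upd u s = Some a"
  using assms update_ctx[OF _ assms(3,4)] update_no_ctx E_subset
  by (cases "ctx \<tau> s = Str []") (auto simp: K_set_def)

text \<open>
  Coherence of the update function: as \<open>J_empty \<epsilon> a\<close> is part of every \<open>K a v\<close> for regular \<open>a\<close>, a symbol
  produced from a string is also produced from every longer string.
\<close>

lemma update_suffix:
  assumes "suffix_of s s'" "upd u s = Some a" "0 \<le> u" "u < 1"
  shows "upd u s' = Some a"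
proof (cases "ctx \<tau> s = Str []")
  case True
  then show ?thesis using assms update_no_ctx[OF True] update_regular by blast
next
  case False
  then have "ctx \<tau> s' = ctx \<tau> s"
    using ctx_nonempty[OF tree False] suffix_of_trans[OF _ assms(1)] ctx_eqI[OF tree] by blast
  then show ?thesis using assms False by (simp add: update_def)
qed

end

section \<open>Independent uniform variables\<close>

abbreviation unif :: "real measure" where
  "unif \<equiv> uniform_measure lborel {0..<1}"

abbreviation canon :: "(int \<Rightarrow> real) measure" where
  "canon \<equiv> (\<Pi>\<^sub>M n\<in>UNIV. unif)"

lemma sets_unif [measurable_cong]: "sets unif = sets borel"
  by simp

lemma prob_space_unif: "prob_space unif"
  by (rule prob_space_uniform_measure) simp_all

interpretation canon: product_prob_space "\<lambda>_::int. unif" "UNIV :: int set"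
  by (intro product_prob_spaceI prob_space_unif)

lemma space_canon [simp]: "space canon = UNIV"
  by (simp add: space_PiM)

lemma measurable_coordinate [measurable]: "(\<lambda>u. u i) \<in> borel_measurable canon"
  using measurable_component_singleton[of i UNIV "\<lambda>_. unif"]
  by (simp add: measurable_cong_sets[OF refl sets_unif])

lemma measure_coordinate:
  assumes "D \<in> sets borel"
  shows "measure canon {u. u i \<in> D} = measure unif D"
proof -
  have "measure unif D = measure (distr canon unif (\<lambda>u. u i)) D"
    using canon.PiM_component[of i] by simp
  also have "\<dots> = measure canon {u. u i \<in> D}"
    using assms by (subst measure_distr) (auto simp: vimage_def)
  finally show ?thesis ..
qed

lemma measure_unif_interval:
  assumes "0 \<le> a" "a \<le> b" "b \<le> 1"
  shows "measure unif {a..<b} = b - a"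
proof -
  have "{0..<1} \<inter> {a..<b} = {a..<b}" using assms by auto
  then show ?thesis using assms
    by (simp add: measure_uniform_measure)
qed

lemma AE_unif_range: "AE x in unif. 0 \<le> x \<and> x < 1"
  by (rule AE_uniform_measureI) auto

lemma AE_unit_range: "AE u in canon. \<forall>i. 0 \<le> u i \<and> u i < 1"
  unfolding AE_all_countable using canon.AE_component[OF UNIV_I AE_unif_range] by blast

text \<open>
  Independence of events is read off from the coordinates that they depend on.  Dependence is
  stated pointwise, so that for the algorithm it follows from congruences of its defining functions.
\<close>

definition determined_by :: "int set \<Rightarrow> (int \<Rightarrow> real) set \<Rightarrow> bool" where
  "determined_by I F \<longleftrightarrow> F \<in> sets canon \<and> (\<forall>u u'. (\<forall>i\<in>I. u i = u' i) \<longrightarrow> (u \<in> F \<longleftrightarrow> u' \<in> F))"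

lemma determined_by_sets: "determined_by I F \<Longrightarrow> F \<in> sets canon"
  by (simp add: determined_by_def)

lemma determined_by_mono: "determined_by I F \<Longrightarrow> I \<subseteq> I' \<Longrightarrow> determined_by I' F"
  unfolding determined_by_def by (meson subsetD)

lemma determined_by_Compl: "determined_by I F \<Longrightarrow> determined_by I (- F)"
proof -
  assume F: "determined_by I F"
  then have "space canon - F \<in> sets canon" by (intro sets.compl_sets determined_by_sets)
  with F show ?thesis by (simp add: determined_by_def Compl_eq_Diff_UNIV)
qed

lemma determined_by_INT:
  assumes "countable T" "T \<noteq> {}" "\<And>t. t \<in> T \<Longrightarrow> determined_by I (F t)"
  shows "determined_by I (\<Inter>t\<in>T. F t)"
  unfolding determined_by_def
proof (intro conjI allI impI)
  show "(\<Inter>t\<in>T. F t) \<in> sets canon"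
    using assms(3) determined_by_sets by (intro sets.countable_INT'[OF assms(1,2)]) blast
next
  fix u u' :: "int \<Rightarrow> real"
  assume "\<forall>i\<in>I. u i = u' i"
  then have "u \<in> F t \<longleftrightarrow> u' \<in> F t" if "t \<in> T" for t
    using assms(3)[OF that] by (simp add: determined_by_def)
  then show "u \<in> (\<Inter>t\<in>T. F t) \<longleftrightarrow> u' \<in> (\<Inter>t\<in>T. F t)" by blast
qed

lemma determined_by_Int:
  "determined_by I F \<Longrightarrow> determined_by I G \<Longrightarrow> determined_by I (F \<inter> G)"
  unfolding determined_by_def by auto

lemma determined_by_coordinate:
  assumes "D \<in> sets borel"
  shows "determined_by {i} {u. u i \<in> D}"
  unfolding determined_by_def
proof (intro conjI)
  have "(\<lambda>u. u i) -` D \<inter> space canon \<in> sets canon"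
    by (rule measurable_sets[OF measurable_coordinate assms])
  then show "{u. u i \<in> D} \<in> sets canon" by (simp add: vimage_def)
qed auto

lemma indep_coordinates: "canon.P.indep_vars (\<lambda>_. unif) (\<lambda>i u. u i) UNIV"
proof (subst canon.P.indep_vars_iff_distr_eq_PiM)
  show "distr canon canon (\<lambda>x. \<lambda>i\<in>UNIV. x i) = (\<Pi>\<^sub>M i\<in>UNIV. distr canon unif (\<lambda>u. u i))"
    by (simp add: canon.PiM_component distr_id restrict_UNIV)
qed auto

lemma measure_Int_determined:
  assumes F: "determined_by I F" and G: "determined_by J G" and IJ: "I \<inter> J = {}"
  shows "measure canon (F \<inter> G) = measure canon F * measure canon G"
proof -
  \<comment> \<open>an event depending only on some coordinates does not notice when the others are set to \<open>0\<close>\<close>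
  define ext where "ext = (\<lambda>b z i. if i \<in> case_bool I J b then z i else (0::real))"
  define H where "H = (\<lambda>b. {z \<in> space (PiM (case_bool I J b) (\<lambda>_. unif)). ext b z \<in> case_bool F G b})"
  have "canon.P.indep_vars (\<lambda>b. PiM (case_bool I J b) (\<lambda>_. unif))
          (\<lambda>b u. restrict (\<lambda>i. u i) (case_bool I J b)) UNIV"
    using IJ by (intro canon.P.indep_vars_restrict[OF indep_coordinates])
      (auto simp: disjoint_family_on_def split: bool.splits)
  moreover have "H b \<in> sets (PiM (case_bool I J b) (\<lambda>_. unif))" for b
  proof -
    have "(\<lambda>z. if i \<in> case_bool I J b then z i else 0) \<in> PiM (case_bool I J b) (\<lambda>_. unif) \<rightarrow>\<^sub>M unif" for i
      by (cases "i \<in> case_bool I J b") (simp_all add: measurable_component_singleton)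
    then have "ext b \<in> PiM (case_bool I J b) (\<lambda>_. unif) \<rightarrow>\<^sub>M canon"
      unfolding ext_def by (rule measurable_abs_UNIV)
    moreover have "case_bool F G b \<in> sets canon"
      using F G by (auto simp: determined_by_def split: bool.splits)
    ultimately have "ext b -` case_bool F G b \<inter> space (PiM (case_bool I J b) (\<lambda>_. unif))
        \<in> sets (PiM (case_bool I J b) (\<lambda>_. unif))"
      by (rule measurable_sets)
    moreover have "H b = ext b -` case_bool F G b \<inter> space (PiM (case_bool I J b) (\<lambda>_. unif))"
      unfolding H_def by blast
    ultimately show ?thesis by simp
  qed
  ultimately have *: "measure canon (\<Inter>b\<in>UNIV. (\<lambda>u. restrict (\<lambda>i. u i) (case_bool I J b)) -` H b \<inter> space canon) =
     (\<Prod>b\<in>UNIV. measure canon ((\<lambda>u. restrict (\<lambda>i. u i) (case_bool I J b)) -` H b \<inter> space canon))"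
    by (intro canon.P.indep_varsD) auto
  have eq: "(\<lambda>u. restrict (\<lambda>i. u i) (case_bool I J b)) -` H b \<inter> space canon = case_bool F G b" for b
  proof -
    have "ext b (restrict (\<lambda>i. u i) (case_bool I J b)) \<in> case_bool F G b \<longleftrightarrow> u \<in> case_bool F G b" for u
      using F G by (cases b) (auto simp: determined_by_def ext_def)
    then show ?thesis by (auto simp: H_def space_PiM)
  qed
  from *[unfolded eq] show ?thesis by (simp add: UNIV_bool Int_commute mult.commute)
qed

lemma distr_shift: "distr canon canon (\<lambda>u n. u (n + k)) = canon"
  using distr_PiM_reindex[of UNIV "\<lambda>_. unif" "\<lambda>n. n + k" UNIV] prob_space_unif
  by (simp add: inj_on_def restrict_def)

section \<open>Runs of the algorithm\<close>

context regular_context_tree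
begin

abbreviation "runs \<equiv> run A \<tau> p \<epsilon>"
abbreviation "con \<equiv> constructible A \<tau> p \<epsilon>"
abbreviation "st \<equiv> start_time A \<tau> p \<epsilon>"
abbreviation "wout \<equiv> window_output A \<tau> p \<epsilon>"
abbreviation "X \<equiv> X_chain A \<tau> p \<epsilon>"

abbreviation produced :: "(int \<Rightarrow> real) \<Rightarrow> int \<Rightarrow> int \<Rightarrow> nat list" where
  "produced u k i \<equiv> map (runs u k) [k..i - 1]"

lemma runs_eq: "runs u k i = the (upd (u i) (Str (produced u k i)))"
  by (subst run.simps) simp

lemma constructible_unique:
  assumes a: "\<And>i. k \<le> i \<Longrightarrow> i \<le> n \<Longrightarrow> upd (u i) (Str (map a [k..i - 1])) = Some (a i)"
    and "k \<le> i" "i \<le> n"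
  shows "runs u k i = a i"
  using assms(2,3)
proof (induction "nat (i - k)" arbitrary: i rule: less_induct)
  case less
  have "produced u k i = map a [k..i - 1]"
    using less.hyps less.prems by (intro map_cong) auto
  then have "upd (u i) (Str (produced u k i)) = Some (a i)"
    using a[OF less.prems] by (simp only:)
  then show ?case by (subst runs_eq) simp
qed

lemma constructible_runs:
  "con u k n \<longleftrightarrow>
     (\<forall>i\<in>{k..n}. runs u k i \<in> A \<and> upd (u i) (Str (produced u k i)) = Some (runs u k i))"
proof
  assume "con u k n"
  then obtain a where "\<forall>i\<in>{k..n}. a i \<in> A \<and> upd (u i) (Str (map a [k..i - 1])) = Some (a i)"
    unfolding constructible_def by blast
  then have a: "\<And>i. k \<le> i \<Longrightarrow> i \<le> n \<Longrightarrow> a i \<in> A \<and> upd (u i) (Str (map a [k..i - 1])) = Some (a i)"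
    by simp
  have eq: "runs u k i = a i" if "k \<le> i" "i \<le> n" for i
    using constructible_unique[of k n u a, OF _ that] a by blast
  have "produced u k i = map a [k..i - 1]" if "k \<le> i" "i \<le> n" for i
    using that eq by (intro map_cong) auto
  then have "upd (u i) (Str (produced u k i)) = Some (a i)" if "k \<le> i" "i \<le> n" for i
    using a[OF that] that by (simp only:)
  with eq a show "\<forall>i\<in>{k..n}. runs u k i \<in> A \<and> upd (u i) (Str (produced u k i)) = Some (runs u k i)"
    by auto
qed (auto simp: constructible_def)

lemma constructible_mono: "con u k n \<Longrightarrow> n' \<le> n \<Longrightarrow> con u k n'"
  by (auto simp: constructible_runs)

lemma produced_split:
  "k \<le> k' \<Longrightarrow> k' \<le> i \<Longrightarrow> produced u k i = map (runs u k) [k..k' - 1] @ map (runs u k) [k'..i - 1]"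
  using upto_split1[of k k' "i - 1"] by (cases "k' = i") (auto simp flip: map_append)

text \<open>
  At every time the run started later knows a suffix of what the earlier run knows, and what it
  decides from this suffix the earlier run decides too.
\<close>

lemma runs_coherent:
  assumes u: "\<forall>i. 0 \<le> u i \<and> u i < 1" and c: "con u k n" "con u k' n"
    and "k \<le> k'" "k' \<le> i" "i \<le> n"
  shows "runs u k i = runs u k' i"
  using assms(5,6)
proof (induction "nat (i - k')" arbitrary: i rule: less_induct)
  case less
  have "map (runs u k) [k'..i - 1] = produced u k' i"
    using less.hyps less.prems by (intro map_cong) auto
  then have "suffix_of (Str (produced u k' i)) (Str (produced u k i))"
    using produced_split[of k k' i u] less.prems assms(4) by (auto simp: suffix_of_Str_Str)
  moreover have "upd (u i) (Str (produced u k' i)) = Some (runs u k' i)"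
    using c(2) less.prems by (auto simp: constructible_runs)
  ultimately have "upd (u i) (Str (produced u k i)) = Some (runs u k' i)"
    using update_suffix u by blast
  moreover have "upd (u i) (Str (produced u k i)) = Some (runs u k i)"
    using c(1) less.prems assms(4) by (auto simp: constructible_runs)
  ultimately show ?case by simp
qed

lemma start_time_exists:
  assumes "con u k n" "k \<le> m"
  obtains k' where "st u m n = Some k'" "k \<le> k'" "k' \<le> m" "con u k' n"
    "\<And>j. k' < j \<Longrightarrow> j \<le> m \<Longrightarrow> \<not> con u j n"
proof -
  define S where "S = {j\<in>{k..m}. con u j n}"
  have "S \<subseteq> {k..m}" by (auto simp: S_def)
  then have S: "finite S" "k \<in> S"
    using assms finite_subset[of S "{k..m}"] by (auto simp: S_def)
  define k' where "k' = Max S"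
  have k': "k' \<in> S" "\<And>j. j \<in> S \<Longrightarrow> j \<le> k'" unfolding k'_def using S Max_in[OF S(1)] Max_ge[OF S(1)] by blast+
  have le: "j \<le> k'" if "j \<le> m" "con u j n" for j
    using k'(2)[of j] k' that by (cases "k \<le> j") (auto simp: S_def)
  then have "(GREATEST k. k \<le> m \<and> con u k n) = k'"
    using k' by (intro Greatest_equality) (auto simp: S_def)
  then have "st u m n = Some k'" using assms by (auto simp: start_time_def)
  moreover have "\<not> con u j n" if "k' < j" "j \<le> m" for j using le[of j] that by auto
  ultimately show thesis using k' by (intro that[of k']) (auto simp: S_def)
qed

lemma start_time_Some:
  "st u m n = Some k \<longleftrightarrow> k \<le> m \<and> con u k n \<and> (\<forall>j\<in>{k<..m}. \<not> con u j n)"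
proof
  assume *: "st u m n = Some k"
  then obtain k0 where k0: "k0 \<le> m" "con u k0 n" unfolding start_time_def by (metis option.distinct(1))
  obtain k' where "st u m n = Some k'" "k' \<le> m" "con u k' n" "\<And>j. k' < j \<Longrightarrow> j \<le> m \<Longrightarrow> \<not> con u j n"
    using start_time_exists[OF k0(2,1)] by metis
  then show "k \<le> m \<and> con u k n \<and> (\<forall>j\<in>{k<..m}. \<not> con u j n)"
    using * by simp
next
  assume *: "k \<le> m \<and> con u k n \<and> (\<forall>j\<in>{k<..m}. \<not> con u j n)"
  then obtain k' where k': "st u m n = Some k'" "k \<le> k'" "k' \<le> m" "con u k' n"
    using start_time_exists by metis
  then have "k' = k" using * by (metis greaterThanAtMost_iff order_le_less)
  with k' show "st u m n = Some k" by simp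
qed

lemma window_output_in_alphabet:
  assumes "i \<in> {m..n}"
  shows "wout u m n i \<in> A"
  using assms one_in_alphabet
  by (auto simp: window_output_def start_time_Some constructible_runs split: option.splits)

lemma X_in_alphabet: "X u i \<in> A"
  by (simp add: X_chain_def window_output_in_alphabet)

lemma X_eq_runs:
  assumes u: "\<forall>i. 0 \<le> u i \<and> u i < 1" and c: "con u k n" and i: "k \<le> i" "i \<le> n"
  shows "X u i = runs u k i"
proof -
  have "con u k i" using constructible_mono[OF c] i by simp
  then obtain k' where "st u i i = Some k'" "k \<le> k'" "k' \<le> i" "con u k' i"
    using start_time_exists i by metis
  then show ?thesis
    using runs_coherent[OF u \<open>con u k i\<close>] by (auto simp: X_chain_def window_output_def)
qed

lemma produced_eq_X:
  assumes "\<forall>i. 0 \<le> u i \<and> u i < 1" "con u k n" "i \<le> n + 1"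
  shows "produced u k i = map (X u) [k..i - 1]"
  using X_eq_runs[OF assms(1,2)] assms(3) by (intro map_cong) auto

lemma window_output_eq_X:
  assumes "\<forall>i. 0 \<le> u i \<and> u i < 1" "st u m n = Some k" "i \<in> {k..n}"
  shows "wout u m n i = X u i"
proof -
  have "con u k n" using assms(2) unfolding start_time_Some by simp
  then show ?thesis using X_eq_runs[OF assms(1), of k n i] assms(3) by (simp add: window_output_def assms(2))
qed

text \<open>
  The following congruences make the past of the chain independent of the next uniform variable.
\<close>

lemma runs_cong:
  assumes "\<And>j. k \<le> j \<Longrightarrow> j \<le> i \<Longrightarrow> u j = u' j" "k \<le> i"
  shows "runs u k i = runs u' k i"
  using assms
proof (induction "nat (i - k)" arbitrary: i rule: less_induct)
  case less
  have "produced u k i = produced u' k i"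
    using less by (intro map_cong) auto
  moreover have "u i = u' i" using less.prems by simp
  ultimately show ?case by (simp only: runs_eq[of u k i] runs_eq[of u' k i])
qed

lemma constructible_cong:
  assumes "\<And>j. j \<le> n \<Longrightarrow> u j = u' j"
  shows "con u k n \<longleftrightarrow> con u' k n"
  using assms by (auto simp: constructible_def)

lemma X_cong:
  assumes "\<And>j. j \<le> i \<Longrightarrow> u j = u' j"
  shows "X u i = X u' i"
proof -
  have st: "st u i i = st u' i i"
    using constructible_cong[OF assms] by (simp add: start_time_def)
  show ?thesis
  proof (cases "st u' i i")
    case (Some k)
    then have "k \<le> i" by (simp add: start_time_Some)
    then show ?thesis using Some st assms runs_cong[of k i u u']
      by (simp add: X_chain_def window_output_def)
  qed (simp add: X_chain_def window_output_def st)
qed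

lemma runs_shift: "runs (\<lambda>n. u (n + c)) k i = runs u (k + c) (i + c)"
proof (induction "nat (i - k)" arbitrary: i rule: less_induct)
  case less
  have "[k + c..i + c - 1] = map (\<lambda>j. j + c) [k..i - 1]"
    by (rule nth_equalityI) auto
  then have "produced (\<lambda>n. u (n + c)) k i = produced u (k + c) (i + c)"
    using less by auto
  then show ?case by (simp add: runs_eq)
qed

lemma constructible_shift: "con (\<lambda>n. u (n + c)) k n \<longleftrightarrow> con u (k + c) (n + c)"
proof -
  have "[k + c..i + c - 1] = map (\<lambda>j. j + c) [k..i - 1]" for i
    by (rule nth_equalityI) auto
  then have "produced (\<lambda>n. u (n + c)) k i = produced u (k + c) (i + c)" for i
    by (auto simp: runs_shift)
  moreover have "(\<forall>i\<in>{k + c..n + c}. P i) \<longleftrightarrow> (\<forall>i\<in>{k..n}. P (i + c))" for P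
    by (metis add_le_cancel_right atLeastAtMost_iff diff_add_cancel)
  ultimately show ?thesis by (simp add: constructible_runs runs_shift)
qed

lemma X_shift: "X (\<lambda>n. u (n + c)) i = X u (i + c)"
proof -
  have *: "st (\<lambda>n. u (n + c)) i i = Some k \<longleftrightarrow> st u (i + c) (i + c) = Some (k + c)" for k
  proof -
    have "(\<forall>j\<in>{k<..i}. P (j + c)) \<longleftrightarrow> (\<forall>j\<in>{k + c<..i + c}. P j)" for P
      by (metis add_less_cancel_right add_le_cancel_right diff_add_cancel greaterThanAtMost_iff)
    from this[of "\<lambda>j. \<not> con u j (i + c)"] show ?thesis
      by (simp only: start_time_Some constructible_shift add_le_cancel_right)
  qed
  show ?thesis
  proof (cases "st (\<lambda>n. u (n + c)) i i")
    case None
    then have "st u (i + c) (i + c) = None" using *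
      by (metis diff_add_cancel not_None_eq)
    with None show ?thesis by (simp add: X_chain_def window_output_def)
  next
    case (Some k)
    then show ?thesis using *[of k] by (simp add: X_chain_def window_output_def runs_shift)
  qed
qed

section \<open>Measurability\<close>

lemma J_empty_borel: "J_empty \<epsilon> a \<in> sets borel"
  by (simp add: J_empty_def)

lemma K_borel: "a \<in> A \<Longrightarrow> K a v \<in> sets borel"
  using J_empty_borel[of a] by (auto simp: K_set_def J_eq)

lemma measurable_update [measurable]: "(\<lambda>x. upd x s) \<in> borel \<rightarrow>\<^sub>M count_space UNIV"
proof -
  have Some: "{x. upd x s = Some a} \<in> sets borel" for a
  proof (cases "ctx \<tau> s = Str []")
    case True
    then show ?thesis using update_no_ctx[OF True] J_empty_borel by (cases "a \<in> E") auto
  next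
    case False
    \<comment> \<open>outside the unit interval the description operator in the update function has no candidate and returns \<open>c\<close>\<close>
    define c :: nat where "c = (THE a. False)"
    have v: "ctx \<tau> s \<in> \<tau>" using ctx_nonempty[OF tree False] by simp
    have "upd x s = Some a \<longleftrightarrow>
        (if 0 \<le> x \<and> x < 1 then a \<in> A \<and> x \<in> K a (ctx \<tau> s) else a = c)" for x
    proof (cases "0 \<le> x \<and> x < 1")
      case True
      then show ?thesis using update_ctx[OF False] by simp
    next
      case F: False
      then have "(\<lambda>a. a \<in> A \<and> x \<in> K a (ctx \<tau> s)) = (\<lambda>a. False)"
        using K_range[OF v] by auto
      then show ?thesis using F False by (auto simp: update_def c_def)
    qed
    then have "{x. upd x s = Some a} =
        (if a \<in> A then K a (ctx \<tau> s) \<inter> {0..<1} else {}) \<union> (if a = c then - {0..<1} else {})"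
      by auto
    moreover have "- {0..<1::real} \<in> sets borel" by simp
    ultimately show ?thesis using K_borel by auto
  qed
  have "{x. upd x s = None} = - (\<Union>a. {x. upd x s = Some a})"
    by (auto simp: not_None_eq[symmetric] simp del: not_None_eq)
  moreover have "(\<Union>a. {x. upd x s = Some a}) \<in> sets borel"
    using Some by (intro sets.countable_UN) auto
  ultimately have None: "{x. upd x s = None} \<in> sets borel"
    by (simp only: borel_comp)
  have "(\<lambda>x. upd x s) -` {b} \<inter> space borel \<in> sets borel" for b
    using Some None by (cases b) (auto simp: vimage_def)
  then show ?thesis
    by (subst measurable_count_space_eq2_countable) auto
qed

lemma measurable_map_list:
  assumes "\<And>i. i \<in> set xs \<Longrightarrow> (\<lambda>x. f x i) \<in> M \<rightarrow>\<^sub>M count_space (UNIV :: 'b::countable set)"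
  shows "(\<lambda>x. map (f x) xs) \<in> M \<rightarrow>\<^sub>M count_space UNIV"
  using assms
proof (induction xs)
  case (Cons i xs)
  have "(\<lambda>x. f x i # l) \<in> M \<rightarrow>\<^sub>M count_space UNIV" for l
    using Cons.prems[of i] by measurable
  then show ?case using Cons
    by (auto intro: measurable_compose_countable[where g = "\<lambda>x. map (f x) xs"])
qed simp

lemma measurable_update_random:
  assumes "g \<in> canon \<rightarrow>\<^sub>M count_space UNIV"
  shows "(\<lambda>u. upd (u i) (Str (g u))) \<in> canon \<rightarrow>\<^sub>M count_space UNIV"
  by (rule measurable_compose_countable[OF _ assms]) measurable

lemma measurable_runs [measurable]: "(\<lambda>u. runs u k i) \<in> canon \<rightarrow>\<^sub>M count_space UNIV"
proof (induction "nat (i - k)" arbitrary: i rule: less_induct)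
  case less
  have "(\<lambda>u. produced u k i) \<in> canon \<rightarrow>\<^sub>M count_space UNIV"
    using less by (intro measurable_map_list) auto
  from measurable_update_random[OF this]
  have "(\<lambda>u. the (upd (u i) (Str (produced u k i)))) \<in> canon \<rightarrow>\<^sub>M count_space UNIV"
    by (rule measurable_compose) simp
  then show ?case by (simp only: runs_eq[symmetric])
qed

lemma measurable_constructible [measurable]: "Measurable.pred canon (\<lambda>u. con u k n)"
proof -
  have [measurable]: "(\<lambda>u. upd (u i) (Str (produced u k i))) \<in> canon \<rightarrow>\<^sub>M count_space UNIV" for i
    by (intro measurable_update_random measurable_map_list) measurable
  have "Measurable.pred canon (\<lambda>u. runs u k i \<in> A \<and> upd (u i) (Str (produced u k i)) = Some (runs u k i))" for i
    by measurable
  then show ?thesis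
    unfolding constructible_runs by (intro pred_intros_finite) auto
qed

lemma measurable_start_time [measurable]: "(\<lambda>u. st u m n) \<in> canon \<rightarrow>\<^sub>M count_space UNIV"
proof -
  have Some: "{u. st u m n = Some k} \<in> sets canon" for k
  proof -
    have "Measurable.pred canon (\<lambda>u. k \<le> m \<and> con u k n \<and> (\<forall>j\<in>{k<..m}. \<not> con u j n))"
      by measurable
    then show ?thesis by (simp add: pred_def start_time_Some)
  qed
  have "{u. st u m n = None} = space canon - (\<Union>k. {u. st u m n = Some k})"
    by (auto simp: not_None_eq[symmetric] simp del: not_None_eq)
  moreover have "(\<Union>k. {u. st u m n = Some k}) \<in> sets canon"
    using Some by (intro sets.countable_UN) auto
  ultimately have None: "{u. st u m n = None} \<in> sets canon"
    by (metis sets.compl_sets)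
  have "(\<lambda>u. st u m n) -` {b} \<inter> space canon \<in> sets canon" for b
    using Some None by (cases b) (auto simp: vimage_def)
  then show ?thesis
    by (subst measurable_count_space_eq2_countable) auto
qed

lemma measurable_window_output [measurable]: "(\<lambda>u. wout u m n i) \<in> canon \<rightarrow>\<^sub>M count_space UNIV"
proof -
  have "(\<lambda>u. case b of Some k \<Rightarrow> runs u k i | None \<Rightarrow> 1) \<in> canon \<rightarrow>\<^sub>M count_space UNIV" for b
    by (cases b) auto
  then show ?thesis
    unfolding window_output_def by (rule measurable_compose_countable) measurable
qed

lemma measurable_X [measurable]: "(\<lambda>u. X u i) \<in> canon \<rightarrow>\<^sub>M count_space UNIV"
  by (simp add: X_chain_def)

lemma measure_J_empty:
  assumes "a \<in> E" "\<tau> \<noteq> {}"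
  shows "measure unif (J_empty \<epsilon> a) = \<epsilon>"
proof -
  obtain v where "v \<in> \<tau>" using assms by auto
  have "real a * \<epsilon> \<le> real e * \<epsilon>" using assms eps_pos by (simp add: mem_E)
  then have "real a * \<epsilon> \<le> 1" using endpoint_bounds[OF \<open>v \<in> \<tau>\<close>, of 0] by simp
  moreover have "0 \<le> (real a - 1) * \<epsilon>" using assms eps_pos by (simp add: mem_E)
  ultimately show ?thesis
    using measure_unif_interval[of "(real a - 1) * \<epsilon>" "real a * \<epsilon>"] eps_pos
    by (simp add: J_empty_def algebra_simps)
qed

lemma measure_K:
  assumes "v \<in> \<tau>" "a \<in> A"
  shows "measure unif (K a v) = pmf (p v) a"
proof -
  note bounds = endpoint_bounds[OF assms(1)]
  have eps: "0 \<le> real e * \<epsilon>" using eps_pos by simp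
  obtain b where b: "a = Suc b" using alphabet_pos[OF assms(2)] by (cases a) auto
  have le: "endpoint v b \<le> endpoint v a"
    using monoD[OF endpoint_mono[OF assms(1)], of b a] b by simp
  have Jeq: "J a v = {endpoint v b..<endpoint v a}" using J_eq[OF assms(2)] b by simp
  have J: "measure unif (J a v) = endpoint v a - endpoint v b"
    unfolding Jeq using le bounds(1)[of b] bounds(2)[of a] eps by (intro measure_unif_interval) linarith+
  show ?thesis
  proof (cases "a \<in> E")
    case False
    have "endpoint v a = endpoint v b + pmf (p v) a"
      using False endpoint_Suc[of v b] unfolding b by simp
    then show ?thesis using J False by (simp add: K_set_def)
  next
    case True
    have "endpoint v a = endpoint v b + pmf (p v) a - \<epsilon>"
      using True endpoint_Suc[of v b] unfolding b by simp
    moreover have "J_empty \<epsilon> a \<inter> J a v = {}"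
      using J_empty_range[OF _ True] J_range[OF assms] by fastforce
    then have "measure unif (J_empty \<epsilon> a \<union> J a v) = measure unif (J_empty \<epsilon> a) + measure unif (J a v)"
      using prob_space.finite_measure[OF prob_space_unif] J_empty_borel
      by (intro finite_measure.finite_measure_Union) (auto simp: Jeq)
    ultimately show ?thesis using J True measure_J_empty[OF True] assms(1) by (auto simp: K_set_def)
  qed
qed

end

section \<open>Termination\<close>

lemma measure_INT_determined:
  assumes "finite S" "\<And>j. j \<in> S \<Longrightarrow> determined_by (I j) (F j)" "disjoint_family_on I S"
  shows "measure canon (\<Inter>j\<in>S. F j) = (\<Prod>j\<in>S. measure canon (F j))"
  using assms
proof (induction S rule: finite_induct)
  case empty
  then show ?case using canon.P.prob_space by simp
next
  case (insert j S)
  show ?case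
  proof (cases "S = {}")
    case False
    have "determined_by (\<Union>i\<in>S. I i) (\<Inter>i\<in>S. F i)"
      using insert.prems(1) insert.hyps(1) False
      by (intro determined_by_INT) (auto intro: countable_finite determined_by_mono)
    moreover have "I j \<inter> (\<Union>i\<in>S. I i) = {}"
      using insert.prems(2) insert.hyps(2) by (fastforce simp: disjoint_family_on_def)
    ultimately have "measure canon (F j \<inter> (\<Inter>i\<in>S. F i)) = measure canon (F j) * measure canon (\<Inter>i\<in>S. F i)"
      using insert.prems(1) by (intro measure_Int_determined) auto
    moreover have "disjoint_family_on I S"
      using insert.prems(2) by (auto simp: disjoint_family_on_def)
    ultimately show ?thesis using insert by simp
  qed simp
qed

lemma determined_empty: "determined_by I {}"
  by (simp add: determined_by_def)

lemma determined_UNIV: "determined_by I UNIV"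
  using sets.top[of canon] by (simp add: determined_by_def)

lemma limsup_exponential_bound:
  fixes ell :: "nat \<Rightarrow> nat"
  assumes "0 < C" "limsup (\<lambda>k. log_nat (ell k) / ereal (C * real k)) < 1"
  obtains c where "0 < c" "c < 1" "\<forall>\<^sub>F k in sequentially. real (ell k) \<le> exp (c * C * real k)"
proof -
  \<comment> \<open>the maximum with \<open>1/2\<close> makes the constant positive and finite\<close>
  have "max (limsup (\<lambda>k. log_nat (ell k) / ereal (C * real k))) (ereal (1/2)) < ereal 1"
    using assms(2) by (simp add: one_ereal_def)
  then obtain c where c: "max (limsup (\<lambda>k. log_nat (ell k) / ereal (C * real k))) (ereal (1/2)) < ereal c"
      "ereal c < ereal 1"
    using ereal_dense2 by blast
  have c': "1/2 < c" "c < 1" using c by simp_all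
  have "\<forall>\<^sub>F k in sequentially. log_nat (ell k) / ereal (C * real k) < ereal c"
    using c(1) by (intro Limsup_lessD) simp
  then have "\<forall>\<^sub>F k in sequentially. real (ell k) \<le> exp (c * C * real k)"
    using eventually_gt_at_top[of 0]
  proof eventually_elim
    case (elim k)
    show ?case
    proof (cases "ell k = 0")
      case False
      have "C * real k > 0" using assms(1) elim(2) by simp
      have "ln (real (ell k)) / (C * real k) < c"
        using elim False assms(1) by (simp add: log_nat_def)
      then have "ln (real (ell k)) < c * C * real k"
        using \<open>C * real k > 0\<close> by (simp add: field_simps)
      then have "exp (ln (real (ell k))) < exp (c * C * real k)" by (simp only: exp_less_cancel_iff)
      then show ?thesis using False by simp
    qed simp
  qed
  with c' show thesis by (intro that[of c]) auto
qed

lemma eventually_linear_le_exp: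
  assumes "(0::real) < D"
  shows "\<forall>\<^sub>F k in sequentially. real k + real d \<le> exp (D * real k)"
  using assms by real_asymp

text \<open>
  Here \<open>d\<close> will be the length of \<open>w\<close> and \<open>q\<close> the probability that a block of \<open>d\<close> times carries \<open>w\<close>,
  so that a window of \<open>L\<close> blocks misses \<open>w\<close> with probability \<open>(1 - q) ^ L\<close>; the constant \<open>C\<close> of the
  growth condition satisfies \<open>1 - q = exp (- C d)\<close>.  As \<open>ell\<close> grows at most like \<open>exp (c C m)\<close> with \<open>c < 1\<close>, a window of
  roughly \<open>ln n / (c C d)\<close> blocks is short enough for the context to fit into a string of
  length \<open>n\<close>, yet long enough for the miss probabilities, of order \<open>n powr (- 1 / c)\<close>, to be summable.
\<close>

lemma window_lengths:
  fixes ell :: "nat \<Rightarrow> nat" and q :: real and d :: nat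
  assumes q: "0 < q" "q < 1" and d: "0 < d"
    and ls: "limsup (\<lambda>k. log_nat (ell k) / ereal (- (1 / real d) * ln (1 - q) * real k)) < 1"
  obtains L :: "nat \<Rightarrow> nat" and n0 where
    "\<And>n m. n0 \<le> n \<Longrightarrow> m \<le> L n * d \<Longrightarrow> ell m + m + d \<le> n"
    "summable (\<lambda>n. (1 - q) ^ L n)"
proof -
  define C where "C = - (1 / real d) * ln (1 - q)"
  have C: "0 < C" using q d by (simp add: C_def divide_neg_pos)
  have Cd: "ln (1 - q) = - (C * real d)" using d by (simp add: C_def)
  obtain c where c: "0 < c" "c < 1" "\<forall>\<^sub>F k in sequentially. real (ell k) \<le> exp (c * C * real k)"
    using limsup_exponential_bound[OF C, of ell] ls unfolding C_def by blast
  define D where "D = c * C"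
  have D: "0 < D" using c C by (simp add: D_def)
  obtain N where N: "\<And>k. N \<le> k \<Longrightarrow> real (ell k) \<le> exp (D * real k) \<and> real k + real d \<le> exp (D * real k)"
    using eventually_conj[OF c(3) eventually_linear_le_exp[OF D, of d]]
    unfolding eventually_sequentially D_def by blast
  \<comment> \<open>the summand \<open>2\<close> pays for the two exponential bounds beyond \<open>N\<close>, the sum for the values before \<open>N\<close>\<close>
  define B where "B = 2 + (\<Sum>m<N. real (ell m + m + d))"
  have B: "2 \<le> B" unfolding B_def by (simp add: sum_nonneg)
  have bound: "real (ell m + m + d) \<le> B * exp (D * real m)" for m
  proof (cases "N \<le> m")
    case True
    have "real (ell m + m + d) \<le> 2 * exp (D * real m)" using N[OF True] by simp
    also have "\<dots> \<le> B * exp (D * real m)" using B by simp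
    finally show ?thesis .
  next
    case False
    have "real (ell m + m + d) \<le> (\<Sum>m<N. real (ell m + m + d))"
      using False by (intro member_le_sum) auto
    also have "\<dots> \<le> B * 1" by (simp add: B_def)
    also have "\<dots> \<le> B * exp (D * real m)" using B D by (intro mult_left_mono) auto
    finally show ?thesis .
  qed
  define L where "L = (\<lambda>n::nat. nat \<lfloor>ln (real n / B) / (D * real d)\<rfloor>)"
  define n0 where "n0 = nat \<lceil>B\<rceil>"
  have Dd: "0 < D * real d" using D d by simp
  have 1: "ell m + m + d \<le> n" if "n0 \<le> n" "m \<le> L n * d" for n m
  proof -
    have nB: "B \<le> real n" using that(1) unfolding n0_def by linarith
    then have "0 \<le> ln (real n / B)" using B by simp
    then have "real (L n) \<le> ln (real n / B) / (D * real d)" using Dd by (simp add: L_def)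
    then have L: "real (L n) * (D * real d) \<le> ln (real n / B)" using Dd by (simp add: pos_le_divide_eq)
    have "real m \<le> real (L n * d)" using that(2) by (simp only: of_nat_le_iff)
    then have "D * real m \<le> D * real (L n * d)" using D by (intro mult_left_mono) auto
    also have "\<dots> \<le> ln (real n / B)" using L by (simp add: mult_ac)
    finally have "exp (D * real m) \<le> exp (ln (real n / B))" by simp
    then have "exp (D * real m) \<le> real n / B" using B nB by simp
    then have "B * exp (D * real m) \<le> real n" using B by (simp add: field_simps)
    with bound[of m] have "real (ell m + m + d) \<le> real n" by linarith
    then show ?thesis by (simp only: of_nat_le_iff)
  qed
  have "summable (\<lambda>n. (exp (C * real d) * B powr (1 / c)) * real n powr (- (1 / c)))"
    using c by (intro summable_mult) (simp add: summable_real_powr_iff)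
  moreover have "\<forall>\<^sub>F n in sequentially.
      norm ((1 - q) ^ L n) \<le> (exp (C * real d) * B powr (1 / c)) * real n powr (- (1 / c))"
    using eventually_gt_at_top[of 0]
  proof eventually_elim
    case (elim n)
    have "ln (real n / B) / (D * real d) \<le> real (L n) + 1" unfolding L_def by linarith
    then have "ln (real n / B) \<le> (real (L n) + 1) * (D * real d)" using Dd by (simp add: pos_divide_le_eq)
    then have "(1 / c) * ln (real n / B) \<le> (1 / c) * ((real (L n) + 1) * (D * real d))"
      using c by (intro mult_left_mono) auto
    also have "\<dots> = (real (L n) + 1) * (C * real d)" using c by (simp add: D_def)
    finally have le: "real (L n) * ln (1 - q) \<le> C * real d - (1 / c) * ln (real n / B)"
      unfolding Cd by (simp add: algebra_simps)
    have "(1 - q) ^ L n = exp (real (L n) * ln (1 - q))" using q by (simp add: exp_of_nat_mult)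
    also have "\<dots> \<le> exp (C * real d - (1 / c) * ln (real n / B))" using le by simp
    also have "\<dots> = exp (C * real d) * exp ((1 / c) * ln B) * exp (- (1 / c) * ln (real n))"
      using elim B c by (simp add: ln_div exp_add[symmetric] algebra_simps diff_divide_distrib)
    also have "\<dots> = (exp (C * real d) * B powr (1 / c)) * real n powr (- (1 / c))"
      using elim B by (simp add: powr_def)
    finally show ?case using q by simp
  qed
  ultimately have "summable (\<lambda>n. (1 - q) ^ L n)"
    by (rule summable_comparison_test_ev[rotated])
  with 1 show thesis by (rule that)
qed

locale reference_tree = regular_context_tree +
  fixes w :: "nat list" and ell :: "nat \<Rightarrow> nat"
  assumes eps_less_1: "\<epsilon> < 1"
    and nonempty_tree: "\<tau> \<noteq> {}"
    and regular_w: "regular_string A \<tau> p \<epsilon> w"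
    and reference: "reference_string \<tau> w ell"
    and growth: "limsup (\<lambda>k. log_nat (ell k) / ereal (C_const \<epsilon> w * real k)) < 1"
begin

abbreviation "d \<equiv> length w"
abbreviation "q \<equiv> \<epsilon> ^ d"

lemma d_pos: "0 < d"
  using reference by (simp add: reference_string_def)

lemma q_bounds: "0 < q" "q < 1"
  using eps_pos eps_less_1 d_pos by (auto simp: power_less_one_iff)

lemma w_regular: "j < d \<Longrightarrow> w ! j \<in> E"
  using regular_w by (auto simp: regular_string_def)

text \<open>
  Once \<open>w\<close> has occurred, the string need not reach further back than the reference function
  prescribes: a context of any infinite past extending \<open>s\<close> is then a suffix of \<open>s\<close> itself.
\<close>

lemma ctx_after_reference:
  assumes s: "s = r @ w @ t" "set s \<subseteq> A" and M: "length t \<le> M"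
    and fits: "\<And>m. m \<le> M \<Longrightarrow> ell m + m + d \<le> length s"
  shows "ctx \<tau> (Str s) \<noteq> Str []"
proof -
  \<comment> \<open>an infinite past extending \<open>s\<close>; any letter of \<open>A\<close> would do instead of \<open>1\<close>\<close>
  define x where "x = (\<lambda>i. if i < length s then rev s ! i else 1)"
  have "rev s ! i \<in> A" if "i < length s" for i
    using s(2) that nth_mem[of i "rev s"] by auto
  then have "range x \<subseteq> A" using one_in_alphabet by (auto simp: x_def)
  define v where "v = ctx \<tau> (Past x)"
  have v: "v \<in> \<tau>" "suffix_of v (Past x)" using ctx_Past[OF \<open>range x \<subseteq> A\<close>] by (auto simp: v_def)
  have sx: "suffix_of (Str s) (Past x)" by (simp add: suffix_of_Str_Past x_def)
  have occ: "x (length t + i) = rev w ! i" if "i < d" for i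
    using that s(1) by (simp add: x_def nth_append)
  have vx: "letter v i = x i" if "enat i < len v" for i
    using v(2) that by (simp add: suffix_of_def)
  have fin: "first_occ w v \<le> enat (length t)" if "enat (length t + d) \<le> len v"
  proof -
    have "letter v (length t + i) = rev w ! i" if "i < d" for i
    proof -
      have "enat (length t + i) < enat (length t + d)" using that by simp
      also have "\<dots> \<le> len v" by fact
      finally show ?thesis using vx occ that by metis
    qed
    then show ?thesis unfolding first_occ_def using that by (intro Inf_lower) auto
  qed
  have lenv: "len v = (case first_occ w v of enat j \<Rightarrow> enat (j + d + ell j) | \<infinity> \<Rightarrow> \<infinity>)"
    using reference v(1) by (simp add: reference_string_def)
  have "first_occ w v \<noteq> \<infinity>"
  proof
    assume *: "first_occ w v = \<infinity>"
    then have "len v = \<infinity>" using lenv by simp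
    then show False using fin * by simp
  qed
  then obtain j where j: "first_occ w v = enat j" by auto
  have len: "len v = enat (j + d + ell j)" using lenv j by simp
  have "j \<le> length t"
  proof (rule ccontr)
    assume "\<not> j \<le> length t"
    then show False using fin j len by simp
  qed
  then have "len v \<le> len (Str s)" using fits[of j] M len by simp
  then have "suffix_of v (Str s)" using suffix_of_linear[OF v(2) sx] by simp
  then have "ctx \<tau> (Str s) = v" using ctx_eqI[OF tree v(1)] by simp
  then show ?thesis using v(1) no_empty by metis
qed

text \<open>The event that the variables of block \<open>b\<close> force the letters of \<open>w\<close>, whatever happened before.\<close>

definition W :: "int \<Rightarrow> (int \<Rightarrow> real) set" where
  "W b = {u. \<forall>j<d. u (b * int d + int j) \<in> J_empty \<epsilon> (w ! j)}"

lemma W_INT: "W b = (\<Inter>j\<in>{..<d}. {u. u (b * int d + int j) \<in> J_empty \<epsilon> (w ! j)})"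
  by (auto simp: W_def)

lemma determined_W: "determined_by {b * int d..<(b + 1) * int d} (W b)"
  unfolding W_INT using d_pos
  by (intro determined_by_INT determined_by_mono[OF determined_by_coordinate[OF J_empty_borel]])
    (auto simp: algebra_simps)

lemma measure_W: "measure canon (W b) = q"
proof -
  have "measure canon (W b) = (\<Prod>j\<in>{..<d}. measure canon {u. u (b * int d + int j) \<in> J_empty \<epsilon> (w ! j)})"
    unfolding W_INT
    by (intro measure_INT_determined[where I = "\<lambda>j. {b * int d + int j}"] determined_by_coordinate J_empty_borel)
      (auto simp: disjoint_family_on_def)
  also have "\<dots> = (\<Prod>j\<in>{..<d}. \<epsilon>)"
    by (intro prod.cong refl)
      (simp only: measure_coordinate J_empty_borel measure_J_empty[OF w_regular nonempty_tree] lessThan_iff)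
  finally show ?thesis by simp
qed

lemma blocks_disjoint:
  assumes "b \<noteq> b'"
  shows "{b * int d..<(b + 1) * int d} \<inter> {b' * int d..<(b' + 1) * int d} = {}"
proof -
  have F: False if "b < b'" "x < (b + 1) * int d" "b' * int d \<le> x" for b b' x
  proof -
    have "(b + 1) * int d \<le> b' * int d" using that(1) by (intro mult_right_mono) auto
    with that show False by linarith
  qed
  show ?thesis using F[of b b'] F[of b' b] assms by fastforce
qed

text \<open>
  A start at block \<open>b\<close> succeeds if the first \<open>R\<close> blocks carry \<open>w\<close> and, from then on, every block
  \<open>b + n\<close> finds \<open>w\<close> in one of the \<open>L n\<close> blocks before it.  A miss is only recorded when the
  window lies beyond the initial blocks, which makes misses independent of the initial blocks.
\<close>

definition initial :: "nat \<Rightarrow> int \<Rightarrow> (int \<Rightarrow> real) set" where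
  "initial R b = (\<Inter>n\<in>{..<R}. W (b + int n))"

definition miss :: "(nat \<Rightarrow> nat) \<Rightarrow> nat \<Rightarrow> int \<Rightarrow> nat \<Rightarrow> (int \<Rightarrow> real) set" where
  "miss L R b n = (if R + L n \<le> n then \<Inter>i\<in>{n - L n..<n}. - W (b + int i) else {})"

definition success :: "(nat \<Rightarrow> nat) \<Rightarrow> nat \<Rightarrow> int \<Rightarrow> (int \<Rightarrow> real) set" where
  "success L R b = initial R b - (\<Union>n\<in>{R..}. miss L R b n)"

lemma determined_W_shift:
  "m \<le> n \<Longrightarrow> n < m' \<Longrightarrow> determined_by {(b + int m) * int d..<(b + int m') * int d} (W (b + int n))"
proof (rule determined_by_mono[OF determined_W])
  assume "m \<le> n" "n < m'"
  then have "(b + int m) * int d \<le> (b + int n) * int d" "(b + int n + 1) * int d \<le> (b + int m') * int d"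
    by (auto intro!: mult_right_mono)
  then show "{(b + int n) * int d..<(b + int n + 1) * int d} \<subseteq> {(b + int m) * int d..<(b + int m') * int d}"
    by auto
qed

lemma determined_initial:
  "determined_by {(b + int 0) * int d..<(b + int R) * int d} (initial R b)"
proof (cases "R = 0")
  case True
  then show ?thesis by (simp add: initial_def determined_UNIV)
next
  case False
  then show ?thesis unfolding initial_def
    by (intro determined_by_INT determined_W_shift) auto
qed

lemma determined_miss:
  assumes "n \<le> N"
  shows "determined_by {(b + int R) * int d..<(b + int N) * int d} (miss L R b n)"
proof (cases "R + L n \<le> n \<and> L n \<noteq> 0")
  case True
  then show ?thesis unfolding miss_def using assms
    by (auto intro!: determined_by_INT determined_by_Compl determined_W_shift)
next
  case False
  then show ?thesis by (auto simp: miss_def determined_empty determined_UNIV)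
qed

lemma sets_miss [measurable]: "miss L R b n \<in> sets canon"
  using determined_miss[of n n] determined_by_sets by blast

lemma measure_W_INT:
  assumes "finite S"
  shows "measure canon (\<Inter>i\<in>S. W (b + int i)) = q ^ card S"
    "measure canon (\<Inter>i\<in>S. - W (b + int i)) = (1 - q) ^ card S"
proof -
  have dj: "disjoint_family_on (\<lambda>i. {(b + int i) * int d..<(b + int i + 1) * int d}) S"
    unfolding disjoint_family_on_def by (intro ballI impI blocks_disjoint) simp
  have "measure canon (- W b) = 1 - q" for b
    using canon.P.prob_compl[OF determined_by_sets[OF determined_W[of b]]]
    by (simp add: measure_W Compl_eq_Diff_UNIV)
  then show "measure canon (\<Inter>i\<in>S. W (b + int i)) = q ^ card S"
    "measure canon (\<Inter>i\<in>S. - W (b + int i)) = (1 - q) ^ card S"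
    using measure_INT_determined[OF assms determined_W dj]
      measure_INT_determined[OF assms determined_by_Compl[OF determined_W] dj]
    by (simp_all add: measure_W)
qed

lemma measure_miss_le: "measure canon (miss L R b n) \<le> (1 - q) ^ L n"
proof (cases "R + L n \<le> n")
  case True
  then show ?thesis using measure_W_INT(2)[of "{n - L n..<n}" b] by (simp add: miss_def)
next
  case False
  then show ?thesis using q_bounds by (simp add: miss_def)
qed

lemma measure_misses_le:
  assumes "summable (\<lambda>n. (1 - q) ^ L n)"
  shows "measure canon (\<Union>n. miss L R b (n + N)) \<le> (\<Sum>n. (1 - q) ^ L (n + N))"
proof -
  have sum: "summable (\<lambda>n. (1 - q) ^ L (n + N))" using assms by (rule summable_ignore_initial_segment)
  have sum': "summable (\<lambda>n. measure canon (miss L R b (n + N)))"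
    by (rule summable_comparison_test[OF _ sum]) (use measure_miss_le in auto)
  have "measure canon (\<Union>n. miss L R b (n + N)) \<le> (\<Sum>n. measure canon (miss L R b (n + N)))"
    using sum' by (intro canon.P.finite_measure_subadditive_countably) auto
  also have "\<dots> \<le> (\<Sum>n. (1 - q) ^ L (n + N))"
    by (intro suminf_le measure_miss_le sum sum')
  finally show ?thesis .
qed

definition early :: "(nat \<Rightarrow> nat) \<Rightarrow> nat \<Rightarrow> nat \<Rightarrow> int \<Rightarrow> (int \<Rightarrow> real) set" where
  "early L R N b = initial R b \<inter> - (\<Union>n\<in>{R..<N}. miss L R b n)"

lemma determined_misses:
  "determined_by {(b + int R) * int d..<(b + int N) * int d} (\<Union>n\<in>{R..<N}. miss L R b n)"
proof (cases "R < N")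
  case True
  have "determined_by {(b + int R) * int d..<(b + int N) * int d} (\<Inter>n\<in>{R..<N}. - miss L R b n)"
    using True by (intro determined_by_INT determined_by_Compl determined_miss) auto
  from determined_by_Compl[OF this] show ?thesis by simp
qed (simp add: determined_empty)

lemma determined_early:
  assumes "R \<le> N"
  shows "determined_by {b * int d..<(b + int N) * int d} (early L R N b)"
proof -
  have "(b + int R) * int d \<le> (b + int N) * int d" "b * int d \<le> (b + int R) * int d"
    using assms by (intro mult_right_mono; simp)+
  then show ?thesis unfolding early_def using determined_initial[of b R] determined_misses[of b R N L]
    by (intro determined_by_Int determined_by_Compl) (auto elim!: determined_by_mono)
qed

lemma measure_early:
  assumes sum: "summable (\<lambda>n. (1 - q) ^ L n)" and R: "(\<Sum>n. (1 - q) ^ L (n + R)) \<le> 1 / 2"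
  shows "q ^ R / 2 \<le> measure canon (early L R N b)"
proof -
  have "measure canon (\<Union>n\<in>{R..<N}. miss L R b n) \<le> measure canon (\<Union>n. miss L R b (n + R))"
    by (intro canon.P.finite_measure_mono) (auto, metis le_add_diff_inverse2)
  also have "\<dots> \<le> 1 / 2" using measure_misses_le[OF sum] R by (rule order_trans)
  finally have "1 / 2 \<le> measure canon (- (\<Union>n\<in>{R..<N}. miss L R b n))"
    using canon.P.prob_compl[OF determined_by_sets[OF determined_misses[of b R N L]]]
    by (simp only: space_canon Compl_eq_Diff_UNIV)
  moreover have "measure canon (early L R N b)
      = measure canon (initial R b) * measure canon (- (\<Union>n\<in>{R..<N}. miss L R b n))"
    unfolding early_def
    by (rule measure_Int_determined[OF determined_initial determined_by_Compl[OF determined_misses]]) auto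
  moreover have "measure canon (initial R b) = q ^ R"
    using measure_W_INT(1)[of "{..<R}" b] by (simp add: initial_def)
  ultimately show ?thesis
    using mult_left_mono[of "1 / 2" "measure canon (- (\<Union>n\<in>{R..<N}. miss L R b n))" "q ^ R"] q_bounds by simp
qed

lemma sets_success [measurable]: "success L R b \<in> sets canon"
  unfolding success_def using determined_by_sets[OF determined_initial] by measurable

text \<open>
  Attempts started \<open>N\<close> blocks apart are independent as long as only their first \<open>N\<close> blocks are
  examined, and each of them survives these with probability at least \<open>q ^ R / 2\<close>.  A failure
  in any later block has small probability when \<open>N\<close> is large, for all \<open>k\<close> attempts together.
\<close>

lemma measure_no_success:
  assumes sum: "summable (\<lambda>n. (1 - q) ^ L n)" and R: "(\<Sum>n. (1 - q) ^ L (n + R)) \<le> 1 / 2" and N: "R \<le> N"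
  shows "measure canon (\<Inter>b\<in>{..m}. - success L R b)
     \<le> (1 - q ^ R / 2) ^ k + real k * (\<Sum>n. (1 - q) ^ L (n + N))"
proof -
  define b where "b = (\<lambda>j::nat. m - int j * int N)"
  define F where "F = (\<Inter>j\<in>{..<k}. - early L R N (b j))"
  define G where "G = (\<Union>j\<in>{..<k}. \<Union>n. miss L R (b j) (n + N))"
  have det: "determined_by {b j * int d..<(b j + int N) * int d} (- early L R N (b j))" for j
    using determined_by_Compl[OF determined_early[OF N]] .
  have F_sets: "F \<in> sets canon"
  proof (cases "k = 0")
    case False
    then show ?thesis unfolding F_def using determined_by_sets[OF det]
      by (intro sets.finite_INT) auto
  qed (use sets.top[of canon] in \<open>simp add: F_def\<close>)
  have G_sets: "G \<in> sets canon" unfolding G_def by measurable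
  have "(\<Inter>b\<in>{..m}. - success L R b) \<subseteq> F \<union> G"
  proof
    fix u assume u: "u \<in> (\<Inter>b\<in>{..m}. - success L R b)"
    show "u \<in> F \<union> G"
    proof (cases "u \<in> F")
      case False
      then obtain j where j: "j < k" "u \<in> early L R N (b j)" by (auto simp: F_def)
      have "u \<notin> success L R (b j)" using u by (auto simp: b_def)
      then obtain n where n: "R \<le> n" "u \<in> miss L R (b j) n"
        using j(2) by (auto simp: success_def early_def)
      then have "N \<le> n" using j(2) by (auto simp: early_def not_less[symmetric])
      then have "u \<in> miss L R (b j) (n - N + N)" using n by simp
      then show ?thesis using j by (auto simp: G_def)
    qed simp
  qed
  then have "measure canon (\<Inter>b\<in>{..m}. - success L R b) \<le> measure canon (F \<union> G)"
    using F_sets G_sets by (intro canon.P.finite_measure_mono) auto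
  also have "\<dots> \<le> measure canon F + measure canon G"
    using F_sets G_sets by (intro measure_Un_le) auto
  also have "measure canon F \<le> (1 - q ^ R / 2) ^ k"
  proof -
    have "disjoint_family_on (\<lambda>j. {b j * int d..<(b j + int N) * int d}) {..<k}"
    proof -
      have F: "{b i * int d..<(b i + int N) * int d} \<inter> {b j * int d..<(b j + int N) * int d} = {}"
        if "i < j" for i j
      proof -
        have "b j + int N = m - (int j - 1) * int N" by (simp add: b_def algebra_simps)
        also have "\<dots> \<le> b i" unfolding b_def using that by (intro diff_mono mult_right_mono) auto
        finally have "(b j + int N) * int d \<le> b i * int d" by (intro mult_right_mono) auto
        then show ?thesis by auto
      qed
      show ?thesis unfolding disjoint_family_on_def
        using F by (metis Int_commute nat_neq_iff)
    qed
    then have "measure canon F = (\<Prod>j\<in>{..<k}. measure canon (- early L R N (b j)))"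
      unfolding F_def by (intro measure_INT_determined[OF _ det]) auto
    also have "\<dots> \<le> (\<Prod>j\<in>{..<k}. 1 - q ^ R / 2)"
    proof (intro prod_mono conjI)
      fix j
      show "measure canon (- early L R N (b j)) \<le> 1 - q ^ R / 2"
        using measure_early[OF sum R, of N "b j"]
          canon.P.prob_compl[OF determined_by_sets[OF determined_early[OF N, of "b j" L]]]
        by (simp only: space_canon Compl_eq_Diff_UNIV)
    qed simp
    finally show ?thesis by simp
  qed
  also have "measure canon G \<le> (\<Sum>j\<in>{..<k}. measure canon (\<Union>n. miss L R (b j) (n + N)))"
    unfolding G_def by (intro canon.P.finite_measure_subadditive_finite) auto
  also have "\<dots> \<le> real k * (\<Sum>n. (1 - q) ^ L (n + N))"
  proof -
    have "(\<Sum>j\<in>{..<k}. measure canon (\<Union>n. miss L R (b j) (n + N)))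
        \<le> (\<Sum>j\<in>{..<k}. \<Sum>n. (1 - q) ^ L (n + N))"
      by (intro sum_mono measure_misses_le[OF sum])
    then show ?thesis by simp
  qed
  finally show ?thesis by simp
qed

lemma AE_success:
  assumes sum: "summable (\<lambda>n. (1 - q) ^ L n)" and R: "(\<Sum>n. (1 - q) ^ L (n + R)) \<le> 1 / 2"
  shows "AE u in canon. \<forall>m. \<exists>b\<le>m. u \<in> success L R b"
proof (subst AE_all_countable, intro allI)
  fix m :: int
  define Z where "Z = (\<Inter>b\<in>{..m}. - success L R b)"
  have Z_sets: "Z \<in> sets canon"
  proof -
    have "Z = space canon - (\<Union>b\<in>{..m}. success L R b)" by (auto simp: Z_def)
    moreover have "(\<Union>b\<in>{..m}. success L R b) \<in> sets canon" by measurable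
    ultimately show ?thesis by (simp only: sets.compl_sets)
  qed
  \<comment> \<open>let first the distance \<open>N\<close> of the attempts and then their number \<open>k\<close> tend to infinity\<close>
  have tail: "(\<lambda>N. \<Sum>n. (1 - q) ^ L (n + N)) \<longlonglongrightarrow> 0"
    by (rule suminf_exist_split2[OF sum])
  have "measure canon Z \<le> (1 - q ^ R / 2) ^ k" for k
  proof (rule LIMSEQ_le_const)
    show "(\<lambda>N. (1 - q ^ R / 2) ^ k + real k * (\<Sum>n. (1 - q) ^ L (n + N))) \<longlonglongrightarrow> (1 - q ^ R / 2) ^ k"
      using tendsto_add[OF tendsto_const tendsto_mult[OF tendsto_const tail]] by simp
    show "\<exists>N0. \<forall>N\<ge>N0. measure canon Z \<le> (1 - q ^ R / 2) ^ k + real k * (\<Sum>n. (1 - q) ^ L (n + N))"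
      using measure_no_success[OF sum R] unfolding Z_def by blast
  qed
  moreover have "(\<lambda>k. (1 - q ^ R / 2) ^ k) \<longlonglongrightarrow> 0"
  proof (rule LIMSEQ_realpow_zero)
    have "q ^ R \<le> 1" by (rule power_le_one) (use q_bounds in linarith)+
    then show "0 \<le> 1 - q ^ R / 2" by simp
    show "1 - q ^ R / 2 < 1" using q_bounds by simp
  qed
  ultimately have "measure canon Z \<le> 0" by (intro LIMSEQ_le_const) auto
  then have "Z \<in> null_sets canon"
    using Z_sets by (simp add: null_sets_def canon.P.emeasure_eq_measure measure_le_0_iff)
  then show "AE u in canon. \<exists>b\<le>m. u \<in> success L R b"
    by (rule AE_I') (auto simp: Z_def)
qed

lemma constructible_extend:
  assumes u: "\<forall>i. 0 \<le> u i \<and> u i < 1" and c: "con u k (i - 1)"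
    and upd: "upd (u i) (Str (produced u k i)) \<noteq> None"
  shows "con u k i"
proof -
  obtain a where a: "upd (u i) (Str (produced u k i)) = Some a" using upd by blast
  then have "runs u k i = a" by (subst runs_eq) simp
  moreover have "a \<in> A" using update_in_alphabet[OF a] u by simp
  ultimately have "runs u k i \<in> A \<and> upd (u i) (Str (produced u k i)) = Some (runs u k i)"
    using a by simp
  then show ?thesis unfolding constructible_runs
  proof (intro ballI)
    fix j assume "j \<in> {k..i}"
    then show "runs u k j \<in> A \<and> upd (u j) (Str (produced u k j)) = Some (runs u k j)"
      using c \<open>runs u k i \<in> A \<and> _\<close> unfolding constructible_runs by (cases "j = i") auto
  qed
qed

lemma runs_on_W:
  assumes u: "\<forall>i. 0 \<le> u i \<and> u i < 1" and c: "con u k n" and W: "u \<in> W b"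
    and "k \<le> b * int d" "(b + 1) * int d \<le> n + 1" and j: "j < d"
  shows "runs u k (b * int d + int j) = w ! j"
proof -
  have "b * int d + int j \<in> {k..n}" using assms(4,5) j by (auto simp: algebra_simps)
  then have "upd (u (b * int d + int j)) (Str (produced u k (b * int d + int j)))
      = Some (runs u k (b * int d + int j))"
    using c unfolding constructible_runs by blast
  moreover have "u (b * int d + int j) \<in> J_empty \<epsilon> (w ! j)" using W j by (simp add: W_def)
  then have "upd (u (b * int d + int j)) (Str (produced u k (b * int d + int j))) = Some (w ! j)"
    using update_regular w_regular[OF j] u by blast
  ultimately show ?thesis by simp
qed

text \<open>
  A run started at a successful block never stops: inside the initial blocks every symbol is
  forced, and afterwards the last \<open>w\<close> is so recent, compared with the length of the run, that
  \<open>ctx_after_reference\<close> applies.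
\<close>

lemma success_constructible:
  assumes u: "\<forall>i. 0 \<le> u i \<and> u i < 1" and succ: "u \<in> success L R b"
    and R: "1 \<le> R" "n0 \<le> R"
    and fits: "\<And>n m. n0 \<le> n \<Longrightarrow> m \<le> L n * d \<Longrightarrow> ell m + m + d \<le> n"
  shows "con u (b * int d) n"
proof -
  define k where "k = b * int d"
  have "con u k (k - 1 + int i)" for i
  proof (induction i)
    case 0
    then show ?case by (simp add: constructible_runs)
  next
    case (Suc i)
    have IH: "con u k (k + int i - 1)" using Suc by (simp add: algebra_simps)
    define n where "n = i div d"
    define s where "s = produced u k (k + int i)"
    have i: "int i = int n * int d + int (i mod d)"
      unfolding n_def by (metis div_mult_mod_eq of_nat_add of_nat_mult)
    have pos: "k + int i = (b + int n) * int d + int (i mod d)"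
      unfolding k_def i by (simp add: algebra_simps)
    have jd: "i mod d < d" using d_pos by simp
    have ni: "n \<le> i" unfolding n_def by simp
    have "upd (u (k + int i)) (Str s) \<noteq> None"
    proof (cases "n < R")
      case True
      then have "u \<in> W (b + int n)" using succ by (auto simp: success_def initial_def)
      then have "u (k + int i) \<in> J_empty \<epsilon> (w ! (i mod d))" using jd by (simp add: pos W_def)
      then show ?thesis using update_regular[OF _ w_regular[OF jd]] u by auto
    next
      case False
      obtain n' where n': "n' < n" "n - L n \<le> n'" "u \<in> W (b + int n')"
      proof (cases "R + L n \<le> n")
        case True
        then have "u \<notin> (\<Inter>i\<in>{n - L n..<n}. - W (b + int i))"
          using succ False by (auto simp: success_def miss_def split: if_splits)
        then show thesis using that by auto
      next
        case F: False
        \<comment> \<open>the window reaches back to the initial blocks, hence contains the last of them\<close>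
        have "R - 1 \<in> {..<R}" using R by simp
        then have "u \<in> W (b + int (R - 1))" using succ unfolding success_def initial_def by blast
        then show thesis using that[of "R - 1"] F False R by auto
      qed
      define k1 where "k1 = (b + int n') * int d"
      have "int n' * int d \<ge> 0" "(int n' + 1) * int d \<le> int n * int d"
        using n'(1) by (auto intro!: mult_right_mono)
      then have k1: "k \<le> k1" "k1 + int d \<le> k + int i" "k1 + int d = (b + int n' + 1) * int d"
        using i by (auto simp: k_def k1_def algebra_simps)
      have occ: "map (runs u k) [k1..k1 + int d - 1] = w"
      proof (rule nth_equalityI)
        fix j assume "j < length (map (runs u k) [k1..k1 + int d - 1])"
        then have "j < d" by simp
        then show "map (runs u k) [k1..k1 + int d - 1] ! j = w ! j"
          using runs_on_W[OF u IH n'(3)] k1 by (simp add: k1_def)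
      qed simp
      have "[k..k + int i - 1] = [k..k1 - 1] @ [k1..k1 + int d - 1] @ [k1 + int d..k + int i - 1]"
        using upto_split1[of k k1 "k + int i - 1"] upto_split1[of k1 "k1 + int d" "k + int i - 1"] k1(1,2) d_pos
        by (cases "k1 + int d = k + int i") auto
      then have s: "s = map (runs u k) [k..k1 - 1] @ w @ map (runs u k) [k1 + int d..k + int i - 1]"
        unfolding s_def by (simp only: map_append occ)
      have len: "length s = i" unfolding s_def by simp
      have "set s \<subseteq> A" using IH unfolding s_def constructible_runs by auto
      moreover have "length (map (runs u k) [k1 + int d..k + int i - 1]) \<le> L n * d"
      proof -
        have "int n \<le> int n' + int (L n)" using n'(2) by linarith
        then have "int n * int d \<le> (int n' + int (L n)) * int d" by (intro mult_right_mono) auto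
        moreover have "int i < int n * int d + int d" using i jd by linarith
        ultimately have "k + int i - (k1 + int d) \<le> int (L n * d)"
          by (simp add: k_def k1_def algebra_simps)
        then show ?thesis by (simp add: nat_le_iff algebra_simps)
      qed
      moreover have "ell m + m + d \<le> length s" if "m \<le> L n * d" for m
        using fits[of n m] that ni R False len by simp
      ultimately have "ctx \<tau> (Str s) \<noteq> Str []" using ctx_after_reference[OF s] by blast
      then show ?thesis using update_ctx(2) u by simp
    qed
    then show ?case using constructible_extend[OF u IH] by (simp add: s_def algebra_simps)
  qed
  from constructible_mono[OF this[of "nat (n - k + 1)"], of n] show ?thesis
    unfolding k_def by simp
qed

text \<open>
  The realisations of the uniform variables used from here on: from arbitrarily far back there are
  runs that never stop and that begin by producing \<open>w\<close>.
\<close>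

definition regular_path :: "(int \<Rightarrow> real) \<Rightarrow> bool" where
  "regular_path u \<longleftrightarrow> (\<forall>i. 0 \<le> u i \<and> u i < 1) \<and>
     (\<forall>m. \<exists>k. k + int d \<le> m \<and> (\<forall>n. con u k n) \<and> (\<forall>j<d. runs u k (k + int j) = w ! j))"

lemma AE_regular_path: "AE u in canon. regular_path u"
proof -
  obtain L n0 where L: "\<And>n m. n0 \<le> n \<Longrightarrow> m \<le> L n * d \<Longrightarrow> ell m + m + d \<le> n"
      "summable (\<lambda>n. (1 - q) ^ L n)"
    by (rule window_lengths[OF q_bounds d_pos growth[unfolded C_const_def]]) (rule that)
  have "\<exists>N. \<forall>n\<ge>N. norm (\<Sum>i. (1 - q) ^ L (i + n)) < 1 / 2"
    by (rule suminf_exist_split[OF _ L(2)]) simp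
  then obtain N where N: "\<And>n. N \<le> n \<Longrightarrow> norm (\<Sum>i. (1 - q) ^ L (i + n)) < 1 / 2" by blast
  define R where "R = Max {N, n0, 1}"
  have R: "1 \<le> R" "n0 \<le> R" "N \<le> R" by (simp_all add: R_def)
  have "(\<Sum>n. (1 - q) ^ L (n + R)) \<le> 1 / 2" using N[OF R(3)] by simp
  from AE_success[OF L(2) this] AE_unit_range show ?thesis
  proof eventually_elim
    case (elim u)
    have "\<exists>k. k + int d \<le> m \<and> (\<forall>n. con u k n) \<and> (\<forall>j<d. runs u k (k + int j) = w ! j)" for m
    proof -
      \<comment> \<open>as \<open>b + 1 \<le> - \<bar>m\<bar> \<le> 0\<close>, multiplying by the block length only lowers it\<close>
      obtain b where b: "b \<le> - \<bar>m\<bar> - 1" "u \<in> success L R b" using elim(1) by blast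
      have c: "con u (b * int d) n" for n
        by (rule success_constructible[OF elim(2) b(2) R(1,2) L(1)])
      have "0 \<in> {..<R}" using R(1) by simp
      then have "u \<in> W (b + int 0)" using b(2) unfolding success_def initial_def by blast
      then have "runs u (b * int d) (b * int d + int j) = w ! j" if "j < d" for j
        using runs_on_W[OF elim(2) c[of "(b + 1) * int d"], of b j] that by simp
      moreover have "b * int d + int d \<le> m"
      proof -
        have "(b + 1) * int d \<le> (- \<bar>m\<bar>) * int d" using b(1) by (intro mult_right_mono) auto
        also have "\<dots> \<le> (- \<bar>m\<bar>) * 1" by (rule mult_left_mono_neg) (use d_pos in linarith)+
        finally show ?thesis by (simp add: algebra_simps)
      qed
      ultimately show ?thesis using c by blast
    qed
    with elim(2) show ?case by (simp add: regular_path_def)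
  qed
qed

end

section \<open>The law of the constructed chain\<close>

lemma measurable_to_subset:
  assumes "f \<in> M \<rightarrow>\<^sub>M count_space UNIV" "\<And>x. x \<in> space M \<Longrightarrow> f x \<in> A"
  shows "f \<in> M \<rightarrow>\<^sub>M count_space A"
  using measurable_restrict_space2[of f M A "count_space UNIV"] assms by (simp add: restrict_count_space Pi_iff)

lemma space_path_space: "space (path_space A) = {x. range x \<subseteq> A}"
  by (auto simp: path_space_def space_PiM PiE_UNIV_domain)

lemma measurable_path_space:
  assumes "\<And>n. (\<lambda>x. f x n) \<in> M \<rightarrow>\<^sub>M count_space A"
  shows "f \<in> M \<rightarrow>\<^sub>M path_space A"
  using measurable_abs_UNIV[of "\<lambda>n x. f x n" M "\<lambda>_. count_space A"] assms by (simp add: path_space_def)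

lemma measurable_path_component [measurable]: "(\<lambda>x. x n) \<in> path_space A \<rightarrow>\<^sub>M count_space A"
  unfolding path_space_def by (rule measurable_component_singleton) simp

lemma measurable_path_shift: "(\<lambda>x n. x (n + k)) \<in> path_space A \<rightarrow>\<^sub>M path_space A"
  by (rule measurable_path_space) measurable

abbreviation past_space :: "'a set \<Rightarrow> (nat \<Rightarrow> 'a) measure" where
  "past_space A \<equiv> (\<Pi>\<^sub>M i\<in>UNIV. count_space A)"

definition past_at :: "int \<Rightarrow> (int \<Rightarrow> 'a) \<Rightarrow> nat \<Rightarrow> 'a" where
  "past_at i x j = x (i - 1 - int j)"

lemma past_at_0: "past_at 0 = past"
  by (simp add: past_at_def past_def fun_eq_iff)

lemma past_at_shift: "past_at 0 (\<lambda>n. x (n + i)) = past_at i x"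
  by (simp add: past_at_def fun_eq_iff algebra_simps)

lemma measurable_past_at [measurable]: "past_at i \<in> path_space A \<rightarrow>\<^sub>M past_space A"
proof -
  have "(\<lambda>x j. past_at i x j) \<in> path_space A \<rightarrow>\<^sub>M past_space A"
    unfolding past_at_def by (rule measurable_abs_UNIV) measurable
  then show ?thesis by simp
qed

lemma sets_past_algebra:
  "B \<in> sets (past_algebra A) \<longleftrightarrow> (\<exists>B'\<in>sets (past_space A). B = {x\<in>space (path_space A). past x \<in> B'})"
proof -
  have "past \<in> space (path_space A) \<rightarrow> space (past_space A)"
    using measurable_space[OF measurable_past_at[of 0 A]] by (auto simp: past_at_0)
  then show ?thesis
    by (auto simp: past_algebra_def sets_vimage_algebra2 vimage_def Int_def conj_commute)
qed

lemma subalgebra_past: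
  assumes "sets \<mu> = sets (path_space A)"
  shows "subalgebra \<mu> (past_algebra A)"
proof -
  have "space \<mu> = space (path_space A)" using assms by (rule sets_eq_imp_space_eq)
  moreover have "B \<in> sets \<mu>" if "B \<in> sets (past_algebra A)" for B
  proof -
    obtain B' where B': "B' \<in> sets (past_space A)" "B = {x\<in>space (path_space A). past x \<in> B'}"
      using \<open>B \<in> sets (past_algebra A)\<close> unfolding sets_past_algebra by blast
    then have "B = past_at 0 -` B' \<inter> space (path_space A)" by (auto simp: past_at_0)
    then show ?thesis using measurable_sets[OF measurable_past_at B'(1), of 0] assms by simp
  qed
  ultimately show ?thesis by (auto simp: subalgebra_def past_algebra_def)
qed

lemma suffix_past_space:
  "{x\<in>space (past_space (A :: nat set)). suffix_of (Str t) (Past x)} \<in> sets (past_space A)"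
  unfolding suffix_of_Str_Past
proof -
  have [measurable]: "(\<lambda>x. x i) \<in> past_space A \<rightarrow>\<^sub>M count_space UNIV" for i
    by (rule measurable_compose[OF measurable_component_singleton[of i UNIV "\<lambda>_. count_space A"]]) auto
  show "{x \<in> space (past_space A). \<forall>i<length t. x i = rev t ! i} \<in> sets (past_space A)"
    by measurable
qed

context reference_tree
begin

definition law :: "(int \<Rightarrow> nat) measure" where
  "law = distr canon (path_space A) X"

lemma measurable_X_path [measurable]: "X \<in> canon \<rightarrow>\<^sub>M path_space A"
  by (rule measurable_path_space, rule measurable_to_subset[OF measurable_X X_in_alphabet])

lemma sets_law: "sets law = sets (path_space A)"
  by (simp add: law_def)

lemma space_law: "space law = space (path_space A)"
  by (simp add: law_def)

lemma prob_space_law: "prob_space law"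
  unfolding law_def by (rule canon.P.prob_space_distr) measurable

lemma measure_law: "B \<in> sets (path_space A) \<Longrightarrow> measure law B = measure canon {u. X u \<in> B}"
  unfolding law_def by (subst measure_distr) (auto simp: vimage_def)

lemma stationary_law_law: "stationary_law A law"
proof -
  have "distr law (path_space A) (\<lambda>x n. x (n + k)) = law" for k
  proof -
    have shift: "(\<lambda>u n. u (n + k)) \<in> canon \<rightarrow>\<^sub>M canon"
      by (rule measurable_abs_UNIV) (simp add: measurable_component_singleton)
    have "distr law (path_space A) (\<lambda>x n. x (n + k))
        = distr canon (path_space A) ((\<lambda>x n. x (n + k)) \<circ> X)"
      unfolding law_def by (rule distr_distr[OF measurable_path_shift measurable_X_path])
    also have "(\<lambda>x n. x (n + k)) \<circ> X = X \<circ> (\<lambda>u n. u (n + k))"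
      by (auto simp: X_shift fun_eq_iff)
    also have "distr canon (path_space A) (X \<circ> (\<lambda>u n. u (n + k)))
        = distr (distr canon canon (\<lambda>u n. u (n + k))) (path_space A) X"
      by (rule distr_distr[OF measurable_X_path shift, symmetric])
    also have "\<dots> = law" unfolding distr_shift law_def ..
    finally show ?thesis .
  qed
  then show ?thesis using prob_space_law sets_law by (simp add: stationary_law_def)
qed

text \<open>
  Some run started before \<open>i\<close> has computed the symbol at \<open>i\<close> from a finite part of the past; by
  coherence the rest of the past does not change it.
\<close>

lemma update_X:
  assumes "regular_path u"
  shows "upd (u i) (Past (past_at i (X u))) = Some (X u i)"
proof -
  have u: "\<forall>i. 0 \<le> u i \<and> u i < 1" using assms by (simp add: regular_path_def)
  obtain k where k: "k + int d \<le> i" "con u k i" using assms unfolding regular_path_def by blast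
  then have "upd (u i) (Str (produced u k i)) = Some (runs u k i)"
    unfolding constructible_runs by simp
  moreover have "suffix_of (Str (produced u k i)) (Past (past_at i (X u)))"
  proof -
    have eq: "produced u k i = map (X u) [k..i - 1]" by (rule produced_eq_X[OF u k(2)]) simp
    have "[k..i - 1] ! (nat (i - k) - Suc j) = i - 1 - int j" if "j < nat (i - k)" for j
      using that by (subst nth_upto) auto
    then show ?thesis unfolding suffix_of_Str_Past eq
      by (auto simp: past_at_def rev_nth)
  qed
  ultimately have "upd (u i) (Past (past_at i (X u))) = Some (runs u k i)"
    using update_suffix u by blast
  then show ?thesis using X_eq_runs[OF u k(2), of i] k(1) by simp
qed

text \<open>Some run has written \<open>w\<close> before time \<open>0\<close>, and a context in which \<open>w\<close> occurs has finite length.\<close>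

lemma finite_context_X:
  assumes "regular_path u"
  shows "\<exists>s. Str s \<in> \<tau> \<and> suffix_of (Str s) (Past (past (X u)))"
proof -
  have u: "\<forall>i. 0 \<le> u i \<and> u i < 1" using assms by (simp add: regular_path_def)
  obtain k where k: "k + int d \<le> 0" "con u k 0" "\<And>j. j < d \<Longrightarrow> runs u k (k + int j) = w ! j"
    using assms unfolding regular_path_def by blast
  define m where "m = nat (- (k + int d))"
  have occ: "past (X u) (m + i) = rev w ! i" if "i < d" for i
  proof -
    have eq: "- 1 - int (m + i) = k + int (d - Suc i)" using k(1) that by (simp add: m_def of_nat_diff)
    have "runs u k (k + int (d - Suc i)) = w ! (d - Suc i)" using that by (intro k(3)) simp
    moreover have "X u (k + int (d - Suc i)) = runs u k (k + int (d - Suc i))"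
      using k(1) that by (intro X_eq_runs[OF u k(2)]) auto
    ultimately show ?thesis using that unfolding past_def eq by (simp only: rev_nth)
  qed
  have r: "range (past (X u)) \<subseteq> A" using X_in_alphabet by (auto simp: past_def)
  define v where "v = ctx \<tau> (Past (past (X u)))"
  have v: "v \<in> \<tau>" "suffix_of v (Past (past (X u)))" using ctx_Past[OF r] by (auto simp: v_def)
  show ?thesis
  proof (cases v)
    case (Str s)
    then show ?thesis using v by blast
  next
    case (Past y)
    then have v': "v = Past (past (X u))" using suffix_of_Past v(2) by metis
    have "first_occ w v \<le> enat m"
      unfolding first_occ_def v' using occ by (intro Inf_lower) auto
    then obtain j where "first_occ w v = enat j" by (cases "first_occ w v") auto
    then have "len v = enat (j + d + ell j)" using reference v(1) by (simp add: reference_string_def)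
    then show ?thesis using Past by simp
  qed
qed

lemma determined_past:
  assumes "B \<in> sets (past_algebra A)"
  shows "determined_by {..<0} {u. X u \<in> B}"
  unfolding determined_by_def
proof (intro conjI allI impI)
  have "B \<in> sets (path_space A)"
    using assms subalgebra_past[OF sets_law] by (auto simp: subalgebra_def sets_law)
  from measurable_sets[OF measurable_X_path this] show "{u. X u \<in> B} \<in> sets canon"
    by (simp add: vimage_def)
next
  fix u u' :: "int \<Rightarrow> real"
  assume "\<forall>i\<in>{..<0}. u i = u' i"
  then have "past (X u) = past (X u')"
    by (auto simp: past_def fun_eq_iff intro!: X_cong)
  moreover have "X u \<in> space (path_space A)" for u
    using X_in_alphabet by (auto simp: space_path_space)
  ultimately show "u \<in> {u. X u \<in> B} \<longleftrightarrow> u' \<in> {u. X u \<in> B}"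
    using assms by (auto simp: sets_past_algebra)
qed

text \<open>
  Conditionally on the past, \<open>X 0\<close> is chosen by the independent variable \<open>u 0\<close>, which falls into
  \<open>K a v\<close> with probability \<open>p(a|v)\<close>.
\<close>

lemma law_transition:
  assumes B: "B \<in> sets (past_algebra A)" and v: "v \<in> \<tau>" "\<And>x. x \<in> B \<Longrightarrow> suffix_of v (Past (past x))"
    and a: "a \<in> A"
  shows "measure law (B \<inter> {x\<in>space law. x 0 = a}) = pmf (p v) a * measure law B"
proof -
  have B_path: "B \<in> sets (path_space A)"
    using B subalgebra_past[OF sets_law] by (auto simp: subalgebra_def sets_law)
  have S: "B \<inter> {x\<in>space law. x 0 = a} \<in> sets (path_space A)"
    unfolding space_law using B_path by measurable
  have [measurable]: "{u. X u \<in> B} \<in> sets canon" "{u. u 0 \<in> K a v} \<in> sets canon"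
    using determined_by_sets[OF determined_past[OF B]]
      determined_by_sets[OF determined_by_coordinate[OF K_borel[OF a], of 0 v]] by simp_all
  have "measure law (B \<inter> {x\<in>space law. x 0 = a}) = measure canon {u. X u \<in> B \<inter> {x\<in>space law. x 0 = a}}"
    using measure_law[OF S] .
  also have "\<dots> = measure canon ({u. X u \<in> B} \<inter> {u. u 0 \<in> K a v})"
  proof (rule canon.P.finite_measure_eq_AE)
    show "AE u in canon. u \<in> {u. X u \<in> B \<inter> {x\<in>space law. x 0 = a}} \<longleftrightarrow> u \<in> {u. X u \<in> B} \<inter> {u. u 0 \<in> K a v}"
      using AE_regular_path
    proof eventually_elim
      case (elim u)
      have u: "0 \<le> u 0" "u 0 < 1" using elim by (auto simp: regular_path_def)
      have up: "upd (u 0) (Past (past (X u))) = Some (X u 0)"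
        using update_X[OF elim, of 0] by (simp add: past_at_0)
      have "X u 0 = a \<longleftrightarrow> u 0 \<in> K a v" if "X u \<in> B"
      proof -
        have c: "ctx \<tau> (Past (past (X u))) = v" using ctx_eqI[OF tree v(1) v(2)[OF that]] .
        then have "ctx \<tau> (Past (past (X u))) \<noteq> Str []" using v(1) no_empty by metis
        from update_ctx(1)[OF this u, of a] show ?thesis using up a unfolding c by simp
      qed
      moreover have "X u \<in> space law"
        using X_in_alphabet by (auto simp: space_law space_path_space)
      ultimately show ?case by auto
    qed
    show "{u. X u \<in> B \<inter> {x\<in>space law. x 0 = a}} \<in> sets canon"
      using measurable_sets[OF measurable_X_path S] by (simp add: vimage_def)
  qed measurable
  also have "\<dots> = measure canon {u. X u \<in> B} * measure canon {u. u 0 \<in> K a v}"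
    by (rule measure_Int_determined[OF determined_past[OF B] determined_by_coordinate[OF K_borel[OF a]]]) simp
  also have "\<dots> = pmf (p v) a * measure law B"
    by (simp add: measure_law[OF B_path] measure_coordinate[OF K_borel[OF a]] measure_K[OF v(1) a] del: measure_uniform_measure)
  finally show ?thesis .
qed

end

text \<open>
  As a function of the past, \<open>p(a|v)\<close> need not be measurable on the uncountably many infinite
  contexts.  The conditional probability is therefore identified separately on each event that a
  given finite context occurs, where it is a constant.
\<close>

lemma real_cond_exp_constant_on:
  fixes \<mu> :: "(int \<Rightarrow> nat) measure"
  assumes "prob_space \<mu>" and sets: "sets \<mu> = sets (path_space A)"
    and C: "C \<in> sets (past_algebra A)"
    and eq: "\<And>B. B \<in> sets (past_algebra A) \<Longrightarrow> B \<subseteq> C \<Longrightarrow>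
      measure \<mu> (B \<inter> {x\<in>space \<mu>. x 0 = a}) = c * measure \<mu> B"
  shows "AE x in \<mu>. x \<in> C \<longrightarrow> real_cond_exp \<mu> (past_algebra A) (indicator {y. y 0 = a}) x = c"
proof -
  interpret prob_space \<mu> by fact
  let ?F = "past_algebra A" and ?f = "indicator {y. y 0 = a} :: (int \<Rightarrow> nat) \<Rightarrow> real"
  have sub: "subalgebra \<mu> ?F" using subalgebra_past[OF sets] .
  interpret finite_measure_subalgebra \<mu> ?F using sub by unfold_locales
  have [measurable_cong]: "sets \<mu> = sets (path_space A)" by fact
  have in_mu: "B \<in> sets \<mu>" if "B \<in> sets ?F" for B using that sub by (auto simp: subalgebra_def)
  have f_meas [measurable]: "?f \<in> borel_measurable \<mu>"
  proof -
    have "{x\<in>space (path_space A). x 0 = a} \<in> sets (path_space A)" by measurable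
    then have "{x\<in>space \<mu>. x 0 = a} \<in> sets \<mu>" by (simp only: sets sets_eq_imp_space_eq[OF sets])
    then show ?thesis
      by (subst measurable_cong[where g = "indicator {x\<in>space \<mu>. x 0 = a}"]) (auto simp: indicator_def)
  qed
  have hC: "(indicator C :: _ \<Rightarrow> real) \<in> borel_measurable ?F" using C by simp
  have int: "integrable \<mu> (\<lambda>x. indicator C x * ?f x)"
    using in_mu[OF C] by (intro integrable_const_bound[of _ 1]) (auto simp: indicator_def)
  have set_eq: "(\<integral>x\<in>B. indicator C x * ?f x \<partial>\<mu>) = (\<integral>x\<in>B. c * indicator C x \<partial>\<mu>)" if B: "B \<in> sets ?F" for B
  proof -
    have BC: "B \<inter> C \<in> sets ?F" using B C by (rule sets.Int)
    have "(\<integral>x\<in>B. indicator C x * ?f x \<partial>\<mu>) = (\<integral>x. indicator (B \<inter> C \<inter> {x\<in>space \<mu>. x 0 = a}) x \<partial>\<mu>)"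
      unfolding set_lebesgue_integral_def
      by (intro Bochner_Integration.integral_cong) (auto simp: indicator_def)
    also have "\<dots> = measure \<mu> (B \<inter> C \<inter> {x\<in>space \<mu>. x 0 = a})"
      by (simp add: Int_absorb2 le_infI2 subset_eq)
    also have "\<dots> = c * measure \<mu> (B \<inter> C)" using eq[OF BC] by simp
    also have "\<dots> = (\<integral>x\<in>B. c * indicator C x \<partial>\<mu>)"
      using sets.sets_into_space[OF in_mu[OF BC]]
      by (simp add: set_lebesgue_integral_def indicator_inter_arith[symmetric] mult.left_commute Int_absorb2)
    finally show ?thesis .
  qed
  have "AE x in \<mu>. real_cond_exp \<mu> ?F (\<lambda>x. indicator C x * ?f x) x = c * indicator C x"
  proof (rule real_cond_exp_charact[OF set_eq int])
    show "integrable \<mu> (\<lambda>x. c * indicator C x)"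
      using in_mu[OF C] by (intro integrable_mult_right integrable_real_indicator) (auto simp: less_top[symmetric])
    show "(\<lambda>x. c * indicator C x) \<in> borel_measurable ?F" using hC by simp
  qed
  moreover have "AE x in \<mu>. real_cond_exp \<mu> ?F (\<lambda>x. indicator C x * ?f x) x = indicator C x * real_cond_exp \<mu> ?F ?f x"
    by (rule real_cond_exp_mult[OF hC f_meas int])
  ultimately show ?thesis by eventually_elim (auto simp: indicator_def)
qed

context reference_tree
begin

lemma compatible_law_law: "compatible_law A \<tau> p law"
proof -
  define T where "T = {v\<in>\<tau>. \<exists>s. v = Str s}"
  have "T \<subseteq> range Str" by (auto simp: T_def)
  then have T: "countable T" by (rule countable_subset) (rule countable_image[OF countableI_type])
  define C where "C = (\<lambda>v. {x\<in>space (path_space A). suffix_of v (Past (past x))})"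
  have C: "C v \<in> sets (past_algebra A)" if v: "v \<in> T" for v
  proof -
    obtain s where s: "v = Str s" using v by (auto simp: T_def)
    have "C v = {x\<in>space (path_space A). past x \<in> {y\<in>space (past_space A). suffix_of (Str s) (Past y)}}"
      by (auto simp: C_def s space_path_space space_PiM past_def)
    then show ?thesis unfolding sets_past_algebra using suffix_past_space by blast
  qed
  have "AE x in law. \<forall>v\<in>T. \<forall>a\<in>A. x \<in> C v \<longrightarrow>
      real_cond_exp law (past_algebra A) (indicator {y. y 0 = a}) x = pmf (p v) a"
    unfolding AE_ball_countable[OF T] AE_ball_countable[OF countableI_type]
  proof (intro ballI)
    fix v a assume va: "v \<in> T" "a \<in> A"
    then have "v \<in> \<tau>" by (simp add: T_def)
    show "AE x in law. x \<in> C v \<longrightarrow>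
        real_cond_exp law (past_algebra A) (indicator {y. y 0 = a}) x = pmf (p v) a"
    proof (rule real_cond_exp_constant_on[OF prob_space_law sets_law C[OF va(1)]])
      fix B assume B: "B \<in> sets (past_algebra A)" "B \<subseteq> C v"
      show "measure law (B \<inter> {x\<in>space law. x 0 = a}) = pmf (p v) a * measure law B"
        by (rule law_transition[OF B(1) \<open>v \<in> \<tau>\<close> _ va(2)]) (use B(2) in \<open>auto simp: C_def\<close>)
    qed
  qed
  moreover have "AE x in law. \<exists>v\<in>T. x \<in> C v"
    unfolding law_def
  proof (subst AE_distr_iff)
    have "(\<Union>v\<in>T. C v) \<in> sets (path_space A)"
      using T C subalgebra_past[OF sets_law]
      by (intro sets.countable_UN') (auto simp: subalgebra_def sets_law)
    moreover have "{x\<in>space (path_space A). \<exists>v\<in>T. x \<in> C v} = (\<Union>v\<in>T. C v)" by (auto simp: C_def)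
    ultimately show "{x\<in>space (path_space A). \<exists>v\<in>T. x \<in> C v} \<in> sets (path_space A)" by simp
    show "AE u in canon. \<exists>v\<in>T. X u \<in> C v"
      using AE_regular_path
    proof eventually_elim
      case (elim u)
      have "X u \<in> space (path_space A)" using X_in_alphabet by (auto simp: space_path_space)
      then show ?case using finite_context_X[OF elim] by (auto simp: T_def C_def)
    qed
  qed measurable
  ultimately show ?thesis
    unfolding compatible_law_def
  proof eventually_elim
    case (elim x)
    then obtain v where v: "v \<in> T" "x \<in> C v" by blast
    then have "ctx \<tau> (Past (past x)) = v" by (intro ctx_eqI[OF tree]) (auto simp: T_def C_def)
    then show ?case using elim(1) v by simp
  qed
qed

end

section \<open>Uniqueness\<close>

context reference_tree
begin

text \<open>
  A variant of the algorithm that never stops and forgets its string instead.  Having a value at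
  every step, it can be compared with another chain by induction on the number of steps.
\<close>

primrec restart :: "nat \<Rightarrow> int \<Rightarrow> nat list \<Rightarrow> (int \<Rightarrow> real) \<Rightarrow> nat list" where
  "restart 0 i t u = t"
| "restart (Suc n) i t u =
     restart n (i + 1) (case upd (u i) (Str t) of Some a \<Rightarrow> t @ [a] | None \<Rightarrow> []) u"

lemma restart_add: "restart (n1 + n2) i t u = restart n2 (i + int n1) (restart n1 i t u) u"
  by (induction n1 arbitrary: i t) (auto simp: algebra_simps)

lemma restart_cong:
  assumes "\<And>j. i \<le> j \<Longrightarrow> u j = u' j"
  shows "restart n i t u = restart n i t u'"
  using assms by (induction n arbitrary: i t) auto

lemma measurable_restart [measurable]: "(\<lambda>u. restart n i t u) \<in> canon \<rightarrow>\<^sub>M count_space UNIV"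
proof (induction n arbitrary: i t)
  case 0
  have "(\<lambda>u. restart 0 i t u) = (\<lambda>_. t)" by simp
  then show ?case by (simp only: measurable_count_space_const)
next
  case (Suc n)
  have "(\<lambda>u. case upd (u i) (Str t) of Some a \<Rightarrow> t @ [a] | None \<Rightarrow> []) \<in> canon \<rightarrow>\<^sub>M count_space UNIV"
    by (rule measurable_compose[OF measurable_compose[OF measurable_coordinate measurable_update]]) simp
  from measurable_compose_countable[OF Suc.IH this] show ?case by simp
qed

lemma determined_restart: "determined_by {i..} {u. restart n i t u \<in> Q}"
  unfolding determined_by_def
proof (intro conjI allI impI)
  show "{u. restart n i t u \<in> Q} \<in> sets canon"
    using measurable_sets[OF measurable_restart, of Q n i t] by (simp add: vimage_def)
next
  fix u u' :: "int \<Rightarrow> real"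
  assume "\<forall>j\<in>{i..}. u j = u' j"
  then have "restart n i t u = restart n i t u'" by (intro restart_cong) auto
  then show "u \<in> {u. restart n i t u \<in> Q} \<longleftrightarrow> u' \<in> {u. restart n i t u \<in> Q}" by simp
qed

text \<open>
  While a run started at \<open>k\<close> does not stop, the restarting algorithm, which knows at least as
  much, does not stop either.
\<close>

lemma restart_extends_run:
  assumes u: "\<forall>i. 0 \<le> u i \<and> u i < 1" and "con u k (i + int n - 1)" "k \<le> i"
    and "suffix_of (Str (produced u k i)) (Str t)"
  shows "suffix_of (Str (produced u k (i + int n))) (Str (restart n i t u))"
  using assms(2-4)
proof (induction n arbitrary: i t)
  case (Suc n)
  have "upd (u i) (Str (produced u k i)) = Some (runs u k i)"
    using Suc.prems(1,2) unfolding constructible_runs by simp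
  then have t: "upd (u i) (Str t) = Some (runs u k i)"
    using update_suffix[OF Suc.prems(3)] u by blast
  have "[k..i] = [k..i - 1] @ [i]" using Suc.prems(2) by (rule upto_rec2)
  then have "produced u k (i + 1) = produced u k i @ [runs u k i]" by simp
  then have "suffix_of (Str (produced u k (i + 1))) (Str (t @ [runs u k i]))"
    using Suc.prems(3) unfolding suffix_of_Str_Str by auto
  moreover have e: "i + 1 + int n = i + int (Suc n)" by simp
  moreover have "con u k (i + 1 + int n - 1)" unfolding e by (rule Suc.prems(1))
  ultimately have "suffix_of (Str (produced u k (i + 1 + int n))) (Str (restart n (i + 1) (t @ [runs u k i]) u))"
    using Suc.prems(2) by (intro Suc.IH) simp_all
  then show ?case unfolding e by (simp add: t)
qed simp

lemma measure_update_le: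
  assumes x: "range x \<subseteq> A" "suffix_of (Str t) (Past x)" and a: "a \<in> A"
  shows "measure unif {r. upd r (Str t) = Some a} \<le> pmf (p (ctx \<tau> (Past x))) a"
proof -
  have "measure unif {r. upd r (Str t) = Some a} \<le> measure unif (K a (ctx \<tau> (Past x)))"
  proof (rule finite_measure.finite_measure_mono_AE[OF prob_space.finite_measure[OF prob_space_unif]])
    show "AE r in unif. r \<in> {r. upd r (Str t) = Some a} \<longrightarrow> r \<in> K a (ctx \<tau> (Past x))"
      using AE_unif_range
    proof eventually_elim
      case (elim r)
      show ?case
      proof
        assume "r \<in> {r. upd r (Str t) = Some a}"
        then have "upd r (Past x) = Some a" using update_suffix[OF x(2)] elim by simp
        then show "r \<in> K a (ctx \<tau> (Past x))" using update_ctx(1)[OF ctx_Past(3)[OF x(1)]] elim by simp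
      qed
    qed
    show "K a (ctx \<tau> (Past x)) \<in> sets unif" using K_borel[OF a] by simp
  qed
  also have "\<dots> = pmf (p (ctx \<tau> (Past x))) a" by (rule measure_K[OF ctx_Past(1)[OF x(1)] a])
  finally show ?thesis .
qed

lemma sets_update: "{r. upd r s = o'} \<in> sets borel"
  using measurable_sets[OF measurable_update, of "{o'}"] by (simp add: vimage_def)

text \<open>
  What the algorithm decides from \<open>t\<close> it decides from every past ending with \<open>t\<close>, so its
  probability of choosing \<open>a\<close> is at most \<open>p(a|v)\<close> for each context \<open>v\<close> of such a past.
\<close>

lemma compatible_transition:
  assumes "stationary_law A \<nu>" "compatible_law A \<tau> p \<nu>"
    and B: "B \<in> sets (past_algebra A)" "\<And>x. x \<in> B \<Longrightarrow> suffix_of (Str t) (Past (past x))"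
    and a: "a \<in> A"
  shows "measure unif {r. upd r (Str t) = Some a} * measure \<nu> B \<le> measure \<nu> (B \<inter> {x\<in>space \<nu>. x 0 = a})"
proof -
  have sets: "sets \<nu> = sets (path_space A)" using assms(1) by (simp add: stationary_law_def)
  note space = sets_eq_imp_space_eq[OF sets]
  interpret prob_space \<nu> using assms(1) by (simp add: stationary_law_def)
  let ?F = "past_algebra A" and ?f = "indicator {y. y 0 = a} :: (int \<Rightarrow> nat) \<Rightarrow> real"
  let ?\<delta> = "measure unif {r. upd r (Str t) = Some a}"
  have sub: "subalgebra \<nu> ?F" using subalgebra_past[OF sets] .
  interpret finite_measure_subalgebra \<nu> ?F using sub by unfold_locales
  have S: "{x\<in>space \<nu>. x 0 = a} \<in> sets \<nu>"
  proof -
    have "{x\<in>space (path_space A). x 0 = a} \<in> sets (path_space A)" by measurable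
    then show ?thesis by (simp only: sets space)
  qed
  have B_nu: "B \<in> sets \<nu>" using B(1) sub by (auto simp: subalgebra_def)
  have f: "integrable \<nu> ?f"
  proof -
    have "integrable \<nu> (indicator {x\<in>space \<nu>. x 0 = a} :: _ \<Rightarrow> real)"
      using S by (intro integrable_real_indicator) (auto simp: less_top[symmetric])
    then show ?thesis
      by (subst Bochner_Integration.integrable_cong[OF refl, where g = "indicator {x\<in>space \<nu>. x 0 = a}"])
        (auto simp: indicator_def)
  qed
  have rce: "integrable \<nu> (real_cond_exp \<nu> ?F ?f)" by (rule real_cond_exp_int(1)[OF f])
  have "?\<delta> * measure \<nu> B = (\<integral>x. indicator B x * ?\<delta> \<partial>\<nu>)"
    using sets.sets_into_space[OF B_nu] by (simp add: Int_absorb2 mult.commute)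
  also have "\<dots> \<le> (\<integral>x. indicator B x * real_cond_exp \<nu> ?F ?f x \<partial>\<nu>)"
  proof (rule integral_mono_AE)
    show "integrable \<nu> (\<lambda>x. indicator B x * ?\<delta>)"
      using B_nu by (intro integrable_mult_left integrable_real_indicator) (auto simp: less_top[symmetric])
    show "integrable \<nu> (\<lambda>x. indicator B x * real_cond_exp \<nu> ?F ?f x)"
      using integrable_mult_indicator[OF B_nu rce] by simp
    show "AE x in \<nu>. indicator B x * ?\<delta> \<le> indicator B x * real_cond_exp \<nu> ?F ?f x"
      using assms(2) AE_space unfolding compatible_law_def
    proof eventually_elim
      case (elim x)
      have "range (past x) \<subseteq> A" using elim(2) unfolding space by (auto simp: space_path_space past_def)
      then show ?case using measure_update_le[of "past x" t a] B(2)[of x] elim(1) a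
        by (auto simp: indicator_def)
    qed
  qed
  also have "\<dots> = (\<integral>x\<in>B. ?f x \<partial>\<nu>)"
    using real_cond_exp_intA[OF f B(1)] by (simp add: set_lebesgue_integral_def)
  also have "\<dots> = (\<integral>x. indicator (B \<inter> {x\<in>space \<nu>. x 0 = a}) x \<partial>\<nu>)"
    unfolding set_lebesgue_integral_def
    by (intro Bochner_Integration.integral_cong) (auto simp: indicator_def)
  also have "\<dots> = measure \<nu> (B \<inter> {x\<in>space \<nu>. x 0 = a})"
    by (simp add: Int_absorb2 le_infI2 subset_eq)
  finally show ?thesis .
qed

definition past_event :: "int \<Rightarrow> (nat \<Rightarrow> nat) set \<Rightarrow> (int \<Rightarrow> nat) set" where
  "past_event i B' = {x\<in>space (path_space A). past_at i x \<in> B'}"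

lemma sets_past_event: "B' \<in> sets (past_space A) \<Longrightarrow> past_event i B' \<in> sets (path_space A)"
  using measurable_sets[OF measurable_past_at, of B' A i]
  by (simp add: past_event_def vimage_def Int_def conj_commute)

lemma compatible_transition_at:
  assumes \<nu>: "stationary_law A \<nu>" "compatible_law A \<tau> p \<nu>"
    and B': "B' \<in> sets (past_space A)" "\<And>z. z \<in> B' \<Longrightarrow> suffix_of (Str t) (Past z)"
    and a: "a \<in> A"
  shows "measure unif {r. upd r (Str t) = Some a} * measure \<nu> (past_event i B')
    \<le> measure \<nu> (past_event i B' \<inter> {x\<in>space (path_space A). x i = a})"
proof -
  have sets: "sets \<nu> = sets (path_space A)" using \<nu>(1) by (simp add: stationary_law_def)
  note space = sets_eq_imp_space_eq[OF sets]
  have shift: "measure \<nu> {x\<in>space (path_space A). (\<lambda>n. x (n + i)) \<in> S} = measure \<nu> S"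
    if S: "S \<in> sets (path_space A)" for S
  proof -
    have "measure \<nu> S = measure (distr \<nu> (path_space A) (\<lambda>x n. x (n + i))) S"
      using \<nu>(1) by (simp add: stationary_law_def)
    also have "\<dots> = measure \<nu> ((\<lambda>x n. x (n + i)) -` S \<inter> space \<nu>)"
      using measurable_path_shift S by (intro measure_distr) (simp_all add: measurable_cong_sets[OF sets refl])
    finally show ?thesis by (simp add: space vimage_def Int_def conj_commute)
  qed
  have sp: "(\<lambda>n. x (n + i)) \<in> space (path_space A)" if "x \<in> space (path_space A)" for x
    using that by (auto simp: space_path_space)
  have B0: "past_event 0 B' \<in> sets (past_algebra A)"
    unfolding sets_past_algebra past_event_def past_at_0 using B'(1) by blast
  have S0: "past_event 0 B' \<inter> {x\<in>space \<nu>. x 0 = a} \<in> sets (path_space A)"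
    unfolding space using sets_past_event[OF B'(1), of 0] by measurable
  have "{x\<in>space (path_space A). (\<lambda>n. x (n + i)) \<in> past_event 0 B'} = past_event i B'"
    using sp by (auto simp: past_event_def past_at_shift)
  moreover have "{x\<in>space (path_space A). (\<lambda>n. x (n + i)) \<in> past_event 0 B' \<inter> {x\<in>space \<nu>. x 0 = a}}
      = past_event i B' \<inter> {x\<in>space (path_space A). x i = a}"
    using sp by (auto simp: past_event_def past_at_shift space)
  moreover have "measure unif {r. upd r (Str t) = Some a} * measure \<nu> (past_event 0 B')
      \<le> measure \<nu> (past_event 0 B' \<inter> {x\<in>space \<nu>. x 0 = a})"
    by (rule compatible_transition[OF \<nu> B0 _ a]) (use B'(2) in \<open>auto simp: past_event_def past_at_0\<close>)
  ultimately show ?thesis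
    using shift[OF sets_past_event[OF B'(1)], of 0] shift[OF S0] by simp
qed

lemma past_event_Suc:
  assumes "B' \<in> sets (past_space A)" "a \<in> A"
  obtains B'' where "B'' \<in> sets (past_space A)" "\<And>z. z \<in> B'' \<longleftrightarrow> z \<in> space (past_space A) \<and> z 0 = a \<and> (\<lambda>j. z (Suc j)) \<in> B'"
    "past_event (i + 1) B'' = past_event i B' \<inter> {x\<in>space (path_space A). x i = a}"
proof
  let ?B = "{z\<in>space (past_space A). z 0 = a \<and> (\<lambda>j. z (Suc j)) \<in> B'}"
  have [measurable]: "(\<lambda>z. z 0) \<in> past_space A \<rightarrow>\<^sub>M count_space A"
    by (rule measurable_component_singleton) simp
  have "(\<lambda>z j. z (Suc j)) \<in> past_space A \<rightarrow>\<^sub>M past_space A"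
    by (rule measurable_abs_UNIV) (rule measurable_component_singleton, simp)
  from measurable_sets[OF this assms(1)]
  have "{z\<in>space (past_space A). (\<lambda>j. z (Suc j)) \<in> B'} \<in> sets (past_space A)"
    by (simp add: vimage_def Int_def conj_commute)
  moreover have "{z\<in>space (past_space A). z 0 = a} \<in> sets (past_space A)" by measurable
  ultimately have "{z\<in>space (past_space A). z 0 = a} \<inter> {z\<in>space (past_space A). (\<lambda>j. z (Suc j)) \<in> B'} \<in> sets (past_space A)"
    by (rule sets.Int[rotated])
  moreover have "?B = {z\<in>space (past_space A). z 0 = a} \<inter> {z\<in>space (past_space A). (\<lambda>j. z (Suc j)) \<in> B'}"
    by auto
  ultimately show "?B \<in> sets (past_space A)" by simp
  show "z \<in> ?B \<longleftrightarrow> z \<in> space (past_space A) \<and> z 0 = a \<and> (\<lambda>j. z (Suc j)) \<in> B'" for z by simp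
  have 0: "past_at (i + 1) x 0 = x i" and Suc: "(\<lambda>j. past_at (i + 1) x (Suc j)) = past_at i x" for x
    by (simp_all add: past_at_def fun_eq_iff algebra_simps)
  show "past_event (i + 1) ?B = past_event i B' \<inter> {x\<in>space (path_space A). x i = a}"
    using measurable_space[OF measurable_past_at] unfolding past_event_def mem_Collect_eq 0 Suc by auto
qed

lemma restart_step:
  fixes n :: nat and i :: int and t :: "nat list" and Q :: "nat list set"
  defines "V \<equiv> \<lambda>a. measure canon {u. restart n (i + 1) (t @ [a]) u \<in> Q}"
    and "V0 \<equiv> measure canon {u. restart n (i + 1) [] u \<in> Q}"
    and "\<delta> \<equiv> \<lambda>a. measure unif {r. upd r (Str t) = Some a}"
  shows "\<exists>D V'. \<delta> sums D \<and> (\<lambda>a. \<delta> a * V a) sums V' \<and>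
    measure canon {u. restart (Suc n) i t u \<in> Q} = V' + (1 - D) * V0"
proof -
  define S where "S = (\<lambda>a. {u. u i \<in> {r. upd r (Str t) = Some a}})"
  define S0 where "S0 = {u. u i \<in> {r. upd r (Str t) = None}}"
  define R where "R = (\<lambda>t. {u. restart n (i + 1) t u \<in> Q})"
  have S: "determined_by {i} (S a)" "determined_by {i} S0" "measure canon (S a) = \<delta> a" for a
    unfolding S_def S0_def \<delta>_def
    by (intro determined_by_coordinate measure_coordinate sets_update)+
  have R: "determined_by {i + 1..} (R t)" for t
    unfolding R_def by (rule determined_restart)
  have meas: "S a \<in> sets canon" "S0 \<in> sets canon" "R t \<in> sets canon" for a t
    using S R determined_by_sets by blast+
  have disj: "disjoint_family S" "disjoint_family (\<lambda>a. S a \<inter> R (t @ [a]))"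
    by (auto simp: disjoint_family_on_def S_def)
  have prod: "measure canon (S a \<inter> R t) = \<delta> a * measure canon (R t)"
    "measure canon (S0 \<inter> R t) = measure canon S0 * measure canon (R t)" for a t
    using measure_Int_determined[OF S(1) R] measure_Int_determined[OF S(2) R] S(3) by simp_all
  have D: "\<delta> sums measure canon (\<Union>a. S a)"
    unfolding S(3)[symmetric] using meas by (intro canon.P.finite_measure_UNION disj) blast
  have V: "V a = measure canon (R (t @ [a]))" "V0 = measure canon (R [])" for a
    by (simp_all add: V_def V0_def R_def)
  have V': "(\<lambda>a. \<delta> a * V a) sums measure canon (\<Union>a. S a \<inter> R (t @ [a]))"
    unfolding V prod(1)[symmetric] using meas by (intro canon.P.finite_measure_UNION disj) blast
  have "S0 = space canon - (\<Union>a. S a)" by (auto simp: S_def S0_def)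
  then have S0: "measure canon S0 = 1 - measure canon (\<Union>a. S a)"
    using canon.P.prob_compl[of "\<Union>a. S a"] meas by auto
  have "{u. restart (Suc n) i t u \<in> Q} = (\<Union>a. S a \<inter> R (t @ [a])) \<union> (S0 \<inter> R [])"
    by (auto simp: S_def S0_def R_def split: option.splits)
  moreover have "measure canon ((\<Union>a. S a \<inter> R (t @ [a])) \<union> (S0 \<inter> R []))
     = measure canon (\<Union>a. S a \<inter> R (t @ [a])) + measure canon (S0 \<inter> R [])"
  proof (rule canon.P.finite_measure_Union)
    show "(\<Union>a. S a \<inter> R (t @ [a])) \<in> sets canon" "S0 \<inter> R [] \<in> sets canon" using meas by auto
    show "(\<Union>a. S a \<inter> R (t @ [a])) \<inter> (S0 \<inter> R []) = {}" by (auto simp: S_def S0_def)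
  qed
  ultimately show ?thesis
    using D V' unfolding prod(2) S0 V(2) by auto
qed

text \<open>
  Condition on the symbol \<open>a\<close> that the chain takes next.  With the algorithm's probability \<open>\<delta> a\<close> the
  algorithm finds the same symbol and remembers \<open>t @ [a]\<close>; the rest of the mass of \<open>a\<close> is compared
  with an algorithm that has stopped and remembers nothing.  Both comparisons are instances of
  the induction hypothesis, since a past ending with \<open>t @ [a]\<close> also ends with the empty string.
\<close>

lemma restart_le_compatible:
  assumes \<nu>: "stationary_law A \<nu>" "compatible_law A \<tau> p \<nu>"
    and S: "S \<in> sets (path_space A)"
    and final: "\<And>x t. x \<in> space (path_space A) \<Longrightarrow> suffix_of (Str t) (Past (past_at N x)) \<Longrightarrow> t \<in> Q \<Longrightarrow> x \<in> S"
    and "B' \<in> sets (past_space A)" "\<And>z. z \<in> B' \<Longrightarrow> suffix_of (Str t) (Past z)"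
    and "i + int n = N"
  shows "measure canon {u. restart n i t u \<in> Q} * measure \<nu> (past_event i B') \<le> measure \<nu> (past_event i B' \<inter> S)"
  using assms(5-7)
proof (induction n arbitrary: i t B')
  case 0
  show ?case
  proof (cases "t \<in> Q")
    case True
    then have "past_event i B' \<inter> S = past_event i B'"
      using final 0 by (auto simp: past_event_def)
    moreover have "{u. restart 0 i t u \<in> Q} = space canon" using True by simp
    ultimately show ?thesis using canon.P.prob_space by simp
  qed simp
next
  case (Suc n)
  interpret prob_space \<nu> using \<nu>(1) by (simp add: stationary_law_def)
  have sets: "sets \<nu> = sets (path_space A)" using \<nu>(1) by (simp add: stationary_law_def)
  define V where "V = (\<lambda>a. measure canon {u. restart n (i + 1) (t @ [a]) u \<in> Q})"
  define V0 where "V0 = measure canon {u. restart n (i + 1) [] u \<in> Q}"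
  define \<delta> where "\<delta> = (\<lambda>a. measure unif {r. upd r (Str t) = Some a})"
  obtain D V' where DV: "\<delta> sums D" "(\<lambda>a. \<delta> a * V a) sums V'"
      "measure canon {u. restart (Suc n) i t u \<in> Q} = V' + (1 - D) * V0"
    using restart_step[of t n i Q] unfolding V_def V0_def \<delta>_def by blast
  define B where "B = past_event i B'"
  define y where "y = (\<lambda>a. measure \<nu> (B \<inter> {x\<in>space (path_space A). x i = a}))"
  define s where "s = (\<lambda>a. measure \<nu> (B \<inter> {x\<in>space (path_space A). x i = a} \<inter> S))"
  have coord: "{x\<in>space (path_space A). x i = a} \<in> sets (path_space A)" for a by measurable
  have B_sets: "B \<in> sets (path_space A)" unfolding B_def by (rule sets_past_event[OF Suc.prems(1)])
  have Ba: "B \<inter> {x\<in>space (path_space A). x i = a} \<in> sets \<nu>" for a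
    using B_sets coord by (simp only: sets sets.Int)
  have Bas: "B \<inter> {x\<in>space (path_space A). x i = a} \<inter> S \<in> sets \<nu>" for a
    unfolding sets by (rule sets.Int[OF Ba[unfolded sets] S])
  have sub: "B \<subseteq> space (path_space A)" by (auto simp: B_def past_event_def)
  have "(\<Union>a. B \<inter> {x\<in>space (path_space A). x i = a}) = B" using sub by auto
  moreover have "y sums measure \<nu> (\<Union>a. B \<inter> {x\<in>space (path_space A). x i = a})"
    unfolding y_def using Ba by (intro finite_measure_UNION) (auto simp: disjoint_family_on_def)
  ultimately have y: "y sums measure \<nu> B" by simp
  have "(\<Union>a. B \<inter> {x\<in>space (path_space A). x i = a} \<inter> S) = B \<inter> S" using sub by auto
  moreover have "s sums measure \<nu> (\<Union>a. B \<inter> {x\<in>space (path_space A). x i = a} \<inter> S)"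
    unfolding s_def using Bas by (intro finite_measure_UNION) (auto simp: disjoint_family_on_def)
  ultimately have s: "s sums measure \<nu> (B \<inter> S)" by simp
  have le: "V a * (\<delta> a * measure \<nu> B) + V0 * (y a - \<delta> a * measure \<nu> B) \<le> s a" for a
  proof (cases "a \<in> A")
    case True
    have \<delta>y: "\<delta> a * measure \<nu> B \<le> y a"
      unfolding \<delta>_def B_def y_def by (rule compatible_transition_at[OF \<nu> Suc.prems(1,2) True])
    obtain B'' where B'': "B'' \<in> sets (past_space A)"
        "\<And>z. z \<in> B'' \<longleftrightarrow> z \<in> space (past_space A) \<and> z 0 = a \<and> (\<lambda>j. z (Suc j)) \<in> B'"
        "past_event (i + 1) B'' = past_event i B' \<inter> {x\<in>space (path_space A). x i = a}"
      by (rule past_event_Suc[OF Suc.prems(1) True, of i]) (rule that)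
    note B''3 = B''(3)[folded B_def]
    have i: "i + 1 + int n = N" using Suc.prems(3) by simp
    have "suffix_of (Str (t @ [a])) (Past z)" if "z \<in> B''" for z
    proof -
      have z: "z 0 = a" "(\<lambda>j. z (Suc j)) \<in> B'" using that B''(2) by auto
      show ?thesis using Suc.prems(2)[OF z(2)] z(1)
        by (auto simp: suffix_of_Str_Past nth_Cons split: nat.splits)
    qed
    from Suc.IH[OF B''(1) this i] have 1: "V a * y a \<le> s a"
      unfolding V_def y_def s_def B''3 by blast
    have "suffix_of (Str []) (Past z)" for z :: "nat \<Rightarrow> nat" by (rule suffix_of_Nil)
    from Suc.IH[OF B''(1) this i] have 2: "V0 * y a \<le> s a"
      unfolding V0_def y_def s_def B''3 by blast
    have "0 \<le> \<delta> a * measure \<nu> B" by (simp add: \<delta>_def)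
    \<comment> \<open>the left-hand side is at most \<open>max (V a) V0 * y a\<close>\<close>
    show ?thesis
    proof (cases "V0 \<le> V a")
      case True
      then have "V0 * (y a - \<delta> a * measure \<nu> B) \<le> V a * (y a - \<delta> a * measure \<nu> B)"
        using \<delta>y by (intro mult_right_mono) auto
      with 1 show ?thesis by (simp add: algebra_simps)
    next
      case False
      then have "V a * (\<delta> a * measure \<nu> B) \<le> V0 * (\<delta> a * measure \<nu> B)"
        using \<open>0 \<le> \<delta> a * measure \<nu> B\<close> by (intro mult_right_mono) auto
      with 2 show ?thesis by (simp add: algebra_simps)
    qed
  next
    case False
    then have "B \<inter> {x\<in>space (path_space A). x i = a} = {}"
      by (auto simp: space_path_space)
    then have "y a = 0" "s a = 0" by (simp_all add: y_def s_def)
    moreover have "\<delta> a = 0"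
    proof -
      have "AE r in unif. r \<in> {r. upd r (Str t) = Some a} \<longleftrightarrow> r \<in> {}"
        using AE_unif_range by eventually_elim (use update_in_alphabet False in auto)
      then have "measure unif {r. upd r (Str t) = Some a} = measure unif {}"
        by (intro measure_eq_AE) (simp_all add: sets_update)
      then show ?thesis by (simp add: \<delta>_def)
    qed
    ultimately show ?thesis by simp
  qed
  have "(\<lambda>a. V a * (\<delta> a * measure \<nu> B) + V0 * (y a - \<delta> a * measure \<nu> B)) sums
      (V' * measure \<nu> B + V0 * (measure \<nu> B - D * measure \<nu> B))"
    using sums_add[OF sums_mult2[OF DV(2), of "measure \<nu> B"]
        sums_mult[OF sums_diff[OF y sums_mult2[OF DV(1), of "measure \<nu> B"]], of V0]]
    by (simp add: mult_ac)
  from sums_le[OF le this s]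
  have "V' * measure \<nu> B + V0 * (measure \<nu> B - D * measure \<nu> B) \<le> measure \<nu> (B \<inter> S)" .
  then show ?case unfolding DV(3) B_def[symmetric] by (simp add: algebra_simps)
qed

definition window_event :: "int \<Rightarrow> int \<Rightarrow> nat list set \<Rightarrow> (int \<Rightarrow> nat) set" where
  "window_event m N L = {x\<in>space (path_space A). map x [m..N - 1] \<in> L}"

lemma sets_window_event: "window_event m N L \<in> sets (path_space A)"
proof -
  have "(\<lambda>x. map x [m..N - 1]) \<in> path_space A \<rightarrow>\<^sub>M count_space UNIV"
    by (rule measurable_map_list, rule measurable_compose[OF measurable_path_component]) simp
  from measurable_sets[OF this, of L] show ?thesis
    by (simp add: window_event_def vimage_def Int_def conj_commute)
qed

lemma window_determined_by_past:
  assumes "m \<le> N" "length b = nat (N - m)" "suffix_of (Str b) (Past (past_at N x))"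
  shows "map x [m..N - 1] = b"
proof (rule nth_equalityI)
  show "length (map x [m..N - 1]) = length b" using assms(1,2) by simp
next
  fix j assume "j < length (map x [m..N - 1])"
  then have j: "j < nat (N - m)" by simp
  then have nth: "[m..N - 1] ! j = m + int j" by (intro nth_upto) auto
  have "past_at N x (nat (N - m) - Suc j) = rev b ! (nat (N - m) - Suc j)"
    using assms(2,3) j unfolding suffix_of_Str_Past by simp
  also have "\<dots> = b ! j" using j assms(2) by (simp add: rev_nth)
  also have "past_at N x (nat (N - m) - Suc j) = x (m + int j)"
    using j assms(1) by (simp add: past_at_def of_nat_diff add.commute)
  finally show "map x [m..N - 1] ! j = b ! j" using j nth by simp
qed

text \<open>
  The restarting algorithm started at \<open>N - n\<close> knows all letters of the window, and knows them to be
  those of the constructed chain, as soon as some run started between \<open>N - n\<close> and \<open>m\<close> survives until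
  \<open>N\<close>.  The probability of this tends to one as \<open>n\<close> grows.
\<close>

lemma law_le_compatible:
  assumes \<nu>: "stationary_law A \<nu>" "compatible_law A \<tau> p \<nu>" and mN: "m \<le> N"
  shows "measure law (window_event m N L) \<le> measure \<nu> (window_event m N L)"
proof -
  interpret prob_space \<nu> using \<nu>(1) by (simp add: stationary_law_def)
  have sets: "sets \<nu> = sets (path_space A)" using \<nu>(1) by (simp add: stationary_law_def)
  define S where "S = window_event m N L"
  have S: "S \<in> sets (path_space A)" unfolding S_def by (rule sets_window_event)
  define Q where "Q = {t. \<exists>r b. t = r @ b \<and> b \<in> L \<and> length b = nat (N - m)}"
  have final: "x \<in> S" if asm: "x \<in> space (path_space A)" "suffix_of (Str t) (Past (past_at N x))" "t \<in> Q" for x t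
  proof -
    obtain r b where b: "t = r @ b" "b \<in> L" "length b = nat (N - m)" using asm(3) by (auto simp: Q_def)
    then have "suffix_of (Str b) (Str t)" by (auto simp: suffix_of_Str_Str)
    then have "suffix_of (Str b) (Past (past_at N x))" using suffix_of_trans that(2) by blast
    from window_determined_by_past[OF mN b(3) this] show ?thesis
      using that(1) b(2) by (simp add: S_def window_event_def)
  qed
  have bound: "measure canon {u. restart n (N - int n) [] u \<in> Q} \<le> measure \<nu> S" for n
  proof -
    have e: "past_event (N - int n) (space (past_space A)) = space (path_space A)"
      using measurable_space[OF measurable_past_at] by (auto simp: past_event_def)
    have "measure canon {u. restart n (N - int n) [] u \<in> Q} * measure \<nu> (past_event (N - int n) (space (past_space A)))
        \<le> measure \<nu> (past_event (N - int n) (space (past_space A)) \<inter> S)"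
      by (rule restart_le_compatible[OF \<nu> S final _ suffix_of_Nil]) simp_all
    moreover have "measure \<nu> (space (path_space A)) = 1"
      using prob_space sets_eq_imp_space_eq[OF sets] by simp
    moreover have "space (path_space A) \<inter> S = S" using sets.sets_into_space[OF S] by blast
    ultimately show ?thesis unfolding e by simp
  qed
  define G where "G = (\<lambda>n::nat. {u. X u \<in> S} \<inter> {u. \<exists>k\<in>{N - int n..m}. con u k (N - 1)})"
  have XS: "{u. X u \<in> S} \<in> sets canon"
    using measurable_sets[OF measurable_X_path S] by (simp add: vimage_def)
  have "Measurable.pred canon (\<lambda>u. \<exists>k\<in>{N - int n..m}. con u k (N - 1))" for n
    by (intro pred_intros_finite) auto
  then have G: "G n \<in> sets canon" for n
    unfolding G_def using XS by (intro sets.Int) (simp_all add: pred_def)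
  have "measure canon (G n) \<le> measure \<nu> S" for n
  proof -
    have "measure canon (G n) \<le> measure canon {u. restart n (N - int n) [] u \<in> Q}"
    proof (rule canon.P.finite_measure_mono_AE)
      show "AE u in canon. u \<in> G n \<longrightarrow> u \<in> {u. restart n (N - int n) [] u \<in> Q}"
        using AE_unit_range
      proof eventually_elim
        case (elim u)
        show ?case
        proof
          assume "u \<in> G n"
          then obtain k where k: "N - int n \<le> k" "k \<le> m" "con u k (N - 1)"
            and XS: "map (X u) [m..N - 1] \<in> L"
            by (auto simp: G_def S_def window_event_def)
          define n1 where "n1 = nat (k - (N - int n))"
          define n2 where "n2 = nat (N - k)"
          have n: "n = n1 + n2" "N - int n + int n1 = k" "k + int n2 = N"
            using k mN by (auto simp: n1_def n2_def)
          have "suffix_of (Str (produced u k (k + int n2))) (Str (restart n2 k (restart n1 (N - int n) [] u) u))"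
            using k(3) n(3) by (intro restart_extends_run[OF elim]) (simp_all add: suffix_of_Nil)
          moreover have "restart n (N - int n) [] u = restart n2 k (restart n1 (N - int n) [] u) u"
            using restart_add[of n1 n2 "N - int n" "[]" u] n(1,2) by simp
          ultimately have suf: "suffix_of (Str (produced u k N)) (Str (restart n (N - int n) [] u))"
            unfolding n(3) by simp
          have "produced u k N = map (X u) [k..N - 1]" by (rule produced_eq_X[OF elim k(3)]) simp
          moreover have "[k..N - 1] = [k..m - 1] @ [m..N - 1]"
            using upto_split1[of k m "N - 1"] k(2) mN by (cases "m = N") auto
          ultimately have "produced u k N = map (X u) [k..m - 1] @ map (X u) [m..N - 1]"
            by (simp only: map_append)
          then obtain r where "restart n (N - int n) [] u = (r @ map (X u) [k..m - 1]) @ map (X u) [m..N - 1]"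
            using suf unfolding suffix_of_Str_Str append_assoc by metis
          moreover have "length (map (X u) [m..N - 1]) = nat (N - m)" by simp
          ultimately show "u \<in> {u. restart n (N - int n) [] u \<in> Q}"
            unfolding Q_def mem_Collect_eq using XS by blast
        qed
      qed
      show "{u. restart n (N - int n) [] u \<in> Q} \<in> sets canon"
        by (rule determined_by_sets[OF determined_restart])
    qed
    then show ?thesis using bound[of n] by simp
  qed
  moreover have "(\<lambda>n. measure canon (G n)) \<longlonglongrightarrow> measure canon (\<Union>n. G n)"
  proof (rule canon.P.finite_Lim_measure_incseq)
    show "range G \<subseteq> sets canon" using G by blast
    show "incseq G" by (fastforce simp: incseq_def G_def)
  qed
  ultimately have "measure canon (\<Union>n. G n) \<le> measure \<nu> S"
    by (intro LIMSEQ_le_const2) auto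
  moreover have "measure canon (\<Union>n. G n) = measure canon {u. X u \<in> S}"
  proof (rule canon.P.finite_measure_eq_AE)
    show "AE u in canon. u \<in> (\<Union>n. G n) \<longleftrightarrow> u \<in> {u. X u \<in> S}"
      using AE_regular_path
    proof eventually_elim
      case (elim u)
      obtain k where k: "k + int d \<le> m" "con u k (N - 1)" using elim unfolding regular_path_def by blast
      then have "k \<in> {N - int (nat (N - k))..m}" using mN by auto
      then show ?case using k(2) unfolding G_def by blast
    qed
    show "(\<Union>n. G n) \<in> sets canon" using G by blast
  qed (rule XS)
  ultimately show ?thesis using measure_law[OF S] by (simp add: S_def)
qed

text \<open>Domination applies to a window event and to its complement, which forces equality.\<close>

lemma compatible_unique:
  assumes \<nu>: "stationary_law A \<nu>" "compatible_law A \<tau> p \<nu>"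
  shows "\<nu> = law"
proof -
  interpret \<nu>: prob_space \<nu> using \<nu>(1) by (simp add: stationary_law_def)
  interpret law: prob_space law by (rule prob_space_law)
  have sets: "sets \<nu> = sets (path_space A)" using \<nu>(1) by (simp add: stationary_law_def)
  have window: "measure \<nu> (window_event m N L) = measure law (window_event m N L)" if "m \<le> N" for m N L
  proof -
    have compl: "window_event m N (- L) = space (path_space A) - window_event m N L"
      by (auto simp: window_event_def)
    have "measure \<nu> (window_event m N (- L)) = 1 - measure \<nu> (window_event m N L)"
      unfolding compl sets_eq_imp_space_eq[OF sets, symmetric]
      using sets_window_event sets by (intro \<nu>.prob_compl) simp
    moreover have "measure law (window_event m N (- L)) = 1 - measure law (window_event m N L)"
      unfolding compl space_law[symmetric]
      using sets_window_event sets_law by (intro law.prob_compl) simp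
    ultimately show ?thesis
      using law_le_compatible[OF \<nu> that, of L] law_le_compatible[OF \<nu> that, of "- L"] by simp
  qed
  show ?thesis
  proof (rule measure_eqI_PiM_infinite[where M = "\<lambda>_. count_space A" and I = UNIV])
    show "sets \<nu> = sets (\<Pi>\<^sub>M n\<in>UNIV. count_space A)" using sets by (simp add: path_space_def)
    show "sets law = sets (\<Pi>\<^sub>M n\<in>UNIV. count_space A)" using sets_law by (simp add: path_space_def)
    show "finite_measure \<nu>" by unfold_locales
    fix Y J assume J: "finite J" "J \<subseteq> (UNIV :: int set)"
    let ?C = "prod_emb UNIV (\<lambda>_. count_space A) J (Pi\<^sub>E J Y)"
    define m where "m = Min (insert 0 J)"
    define N where "N = Max (insert 0 J) + 1"
    have J': "J \<subseteq> {m..N - 1}" using J(1) by (auto simp: m_def N_def)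
    have "m \<le> 0" "0 < N" using J(1) by (simp_all add: m_def N_def add_pos_nonneg)
    have C: "x \<in> ?C \<longleftrightarrow> x \<in> space (path_space A) \<and> (\<forall>j\<in>J. x j \<in> Y j)" for x
      by (auto simp: prod_emb_def path_space_def space_PiM PiE_UNIV_domain)
    have "?C = window_event m N {map x [m..N - 1] |x. x \<in> ?C}"
    proof (intro set_eqI iffI)
      fix x assume "x \<in> window_event m N {map x [m..N - 1] |x. x \<in> ?C}"
      then obtain z where x: "x \<in> space (path_space A)" and z: "z \<in> ?C" "map x [m..N - 1] = map z [m..N - 1]"
        unfolding window_event_def by auto
      then have "x j = z j" if "j \<in> J" for j using that J' by auto
      then show "x \<in> ?C" using x z(1) unfolding C by auto
    next
      fix x assume "x \<in> ?C"
      then show "x \<in> window_event m N {map x [m..N - 1] |x. x \<in> ?C}"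
        unfolding window_event_def using C by blast
    qed
    then have "measure \<nu> ?C = measure law ?C"
      using window[of m N "{map x [m..N - 1] |x. x \<in> ?C}"] \<open>m \<le> 0\<close> \<open>0 < N\<close> by simp
    then show "emeasure \<nu> ?C = emeasure law ?C"
      by (simp add: \<nu>.emeasure_eq_measure law.emeasure_eq_measure)
  qed
qed

end

section \<open>The outputs of the algorithm\<close>

lemma iid_uniform_canonical:
  assumes "iid_uniform M U"
  shows "(\<lambda>\<omega> n. U n \<omega>) \<in> M \<rightarrow>\<^sub>M canon" "distr M canon (\<lambda>\<omega> n. U n \<omega>) = canon"
proof -
  interpret prob_space M using assms by (simp add: iid_uniform_def)
  have ind: "indep_vars (\<lambda>_. borel) U UNIV" and U: "\<And>n. distr M borel (U n) = unif"
    using assms by (auto simp: iid_uniform_def)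
  have rv: "U n \<in> borel_measurable M" for n using ind by (simp add: indep_vars_def)
  have cong: "sets canon = sets (\<Pi>\<^sub>M n\<in>(UNIV :: int set). (borel :: real measure))"
    by (rule sets_PiM_cong) simp_all
  have "(\<lambda>\<omega> n. U n \<omega>) \<in> M \<rightarrow>\<^sub>M (\<Pi>\<^sub>M n\<in>(UNIV :: int set). (borel :: real measure))"
    by (rule measurable_abs_UNIV) (rule rv)
  then show "(\<lambda>\<omega> n. U n \<omega>) \<in> M \<rightarrow>\<^sub>M canon" by (simp only: measurable_cong_sets[OF refl cong])
  have "distr M canon (\<lambda>\<omega> n. U n \<omega>) = distr M (\<Pi>\<^sub>M n\<in>(UNIV :: int set). borel) (\<lambda>\<omega>. \<lambda>n\<in>UNIV. U n \<omega>)"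
    by (rule distr_cong) (simp_all add: cong restrict_def)
  also have "\<dots> = (\<Pi>\<^sub>M n\<in>UNIV. distr M borel (U n))"
    using indep_vars_iff_distr_eq_PiM[where I = UNIV and M' = "\<lambda>_. borel" and X = U] ind rv by simp
  finally show "distr M canon (\<lambda>\<omega> n. U n \<omega>) = canon" unfolding U .
qed

lemma (in reference_tree) samples:
  assumes "iid_uniform M U"
  defines "u \<equiv> \<lambda>\<omega> n. U n \<omega>"
  shows "AE \<omega> in M. \<forall>m n. m \<le> n \<longrightarrow>
      (\<exists>k. st (u \<omega>) m n = Some k \<and> (\<forall>i\<in>{k..n}. wout (u \<omega>) m n i = X (u \<omega>) i))"
    and "(\<lambda>\<omega>. X (u \<omega>) n) \<in> M \<rightarrow>\<^sub>M count_space A"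
    and "chain_law A M (\<lambda>n \<omega>. X (u \<omega>) n) = law"
    and "(\<lambda>\<omega>. \<lambda>i\<in>{m..n}. wout (u \<omega>) m n i) \<in> M \<rightarrow>\<^sub>M string_space A m n"
    and "m \<le> n \<Longrightarrow> distr M (string_space A m n) (\<lambda>\<omega>. \<lambda>i\<in>{m..n}. wout (u \<omega>) m n i) = marginal A m n law"
proof -
  have u: "u \<in> M \<rightarrow>\<^sub>M canon" "distr M canon u = canon"
    unfolding u_def by (rule iid_uniform_canonical[OF assms(1)])+
  have paths: "AE \<omega> in M. regular_path (u \<omega>)"
    by (rule AE_distrD[OF u(1)], subst u(2), rule AE_regular_path)
  have out: "\<exists>k. st v m n = Some k \<and> (\<forall>i\<in>{k..n}. wout v m n i = X v i)"
    if v: "regular_path v" for v m n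
  proof -
    have v': "\<forall>i. 0 \<le> v i \<and> v i < 1" using v by (simp add: regular_path_def)
    obtain k where "k + int d \<le> m" "con v k n" using v unfolding regular_path_def by blast
    then obtain k' where "st v m n = Some k'" using start_time_exists[of v k n m] by auto
    then show ?thesis using window_output_eq_X[OF v'] by blast
  qed
  show "AE \<omega> in M. \<forall>m n. m \<le> n \<longrightarrow>
      (\<exists>k. st (u \<omega>) m n = Some k \<and> (\<forall>i\<in>{k..n}. wout (u \<omega>) m n i = X (u \<omega>) i))"
    using paths by eventually_elim (use out in blast)
  show "(\<lambda>\<omega>. X (u \<omega>) n) \<in> M \<rightarrow>\<^sub>M count_space A"
    by (rule measurable_compose[OF u(1) measurable_to_subset[OF measurable_X X_in_alphabet]])
  have "chain_law A M (\<lambda>n \<omega>. X (u \<omega>) n) = distr M (path_space A) (X \<circ> u)"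
    by (simp add: chain_law_def comp_def)
  also have "\<dots> = distr (distr M canon u) (path_space A) X"
    by (rule distr_distr[OF measurable_X_path u(1), symmetric])
  finally show "chain_law A M (\<lambda>n \<omega>. X (u \<omega>) n) = law" unfolding u(2) law_def .
  have W: "(\<lambda>v. \<lambda>i\<in>{m..n}. wout v m n i) \<in> canon \<rightarrow>\<^sub>M string_space A m n"
    unfolding string_space_def
    by (rule measurable_restrict, rule measurable_to_subset[OF measurable_window_output window_output_in_alphabet])
  then show "(\<lambda>\<omega>. \<lambda>i\<in>{m..n}. wout (u \<omega>) m n i) \<in> M \<rightarrow>\<^sub>M string_space A m n"
    by (rule measurable_compose[OF u(1)])
  have R: "(\<lambda>x. restrict x {m..n}) \<in> path_space A \<rightarrow>\<^sub>M string_space A m n"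
    unfolding string_space_def by (rule measurable_restrict) measurable
  assume "m \<le> n"
  have "distr M (string_space A m n) (\<lambda>\<omega>. \<lambda>i\<in>{m..n}. wout (u \<omega>) m n i)
      = distr (distr M canon u) (string_space A m n) (\<lambda>v. \<lambda>i\<in>{m..n}. wout v m n i)"
    by (subst distr_distr[OF W u(1)]) (simp add: comp_def)
  also have "\<dots> = distr canon (string_space A m n) ((\<lambda>x. restrict x {m..n}) \<circ> X)"
    unfolding u(2)
  proof (rule distr_cong_AE[OF refl refl])
    show "AE v in canon. (\<lambda>i\<in>{m..n}. wout v m n i) = ((\<lambda>x. restrict x {m..n}) \<circ> X) v"
      using AE_regular_path
    proof eventually_elim
      case (elim v)
      obtain k where k: "st v m n = Some k" "\<forall>i\<in>{k..n}. wout v m n i = X v i"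
        using out[OF elim] by blast
      then have "k \<le> m" by (simp add: start_time_Some)
      with k(2) show ?case by (auto intro!: restrict_ext)
    qed
    show "(\<lambda>x. restrict x {m..n}) \<circ> X \<in> canon \<rightarrow>\<^sub>M string_space A m n"
      by (rule measurable_comp[OF measurable_X_path R])
  qed (rule W)
  also have "\<dots> = marginal A m n law"
    unfolding marginal_def law_def by (rule distr_distr[OF R measurable_X_path, symmetric])
  finally show "distr M (string_space A m n) (\<lambda>\<omega>. \<lambda>i\<in>{m..n}. wout (u \<omega>) m n i) = marginal A m n law" .
qed

theorem corollary5p1:
  fixes A :: "nat set"
    and \<tau> :: "nat pstring set"
    and p :: "nat pstring \<Rightarrow> nat pmf"
    and \<epsilon> :: real
    and w :: "nat list"
    and ell :: "nat \<Rightarrow> nat"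
  assumes "alphabet A"
    and "prob_context_tree A \<tau> p"
    and "unbounded \<tau>"
    and "0 < \<epsilon>" and "\<epsilon> < 1"
    and "regular_symbols A \<tau> p \<epsilon> = {1..card (regular_symbols A \<tau> p \<epsilon>)}"
    and "regular_string A \<tau> p \<epsilon> w"
    and "reference_string \<tau> w ell"
    and "limsup (\<lambda>k. log_nat (ell k) / ereal (C_const \<epsilon> w * real k)) < 1"
  shows "\<exists>\<mu>. stationary_law A \<mu> \<and> compatible_law A \<tau> p \<mu> \<and>
           (\<forall>\<nu>. stationary_law A \<nu> \<and> compatible_law A \<tau> p \<nu> \<longrightarrow> \<nu> = \<mu>) \<and>
           (\<forall>(M :: 'w measure) U. iid_uniform M U \<longrightarrow>
              (let u = (\<lambda>\<omega> n. U n \<omega>);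
                   X = (\<lambda>n \<omega>. X_chain A \<tau> p \<epsilon> (u \<omega>) n);
                   S = (\<lambda>m n \<omega>. \<lambda>i\<in>{m..n}. window_output A \<tau> p \<epsilon> (u \<omega>) m n i)
               in (AE \<omega> in M. \<forall>m n. m \<le> n \<longrightarrow>
                     (\<exists>k. start_time A \<tau> p \<epsilon> (u \<omega>) m n = Some k \<and>
                          (\<forall>i\<in>{k..n}. window_output A \<tau> p \<epsilon> (u \<omega>) m n i = X i \<omega>))) \<and>
                  (\<forall>n. X n \<in> M \<rightarrow>\<^sub>M count_space A) \<and>
                  chain_law A M X = \<mu> \<and>
                  (\<forall>m n. m \<le> n \<longrightarrow>
                     S m n \<in> M \<rightarrow>\<^sub>M string_space A m n \<and>
                     distr M (string_space A m n) (S m n) = marginal A m n \<mu>)))"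
proof -
  have no_empty: "Str [] \<notin> \<tau>"
  proof
    assume *: "Str [] \<in> \<tau>"
    have "enat (length w) \<le> len (Str [])"
      using assms(8) * by (auto simp: reference_string_def split: enat.splits)
    then show False using assms(8) by (simp add: reference_string_def)
  qed
  have nonempty: "\<tau> \<noteq> {}"
    using assms(3) by (auto simp: unbounded_def bot_enat_def)
  interpret reference_tree A \<tau> p \<epsilon> w ell
    using assms no_empty nonempty by unfold_locales
  show ?thesis
    unfolding Let_def
  proof (intro exI[of _ law] conjI allI impI, goal_cases)
    case 1
    show ?case by (rule stationary_law_law)
  next
    case 2
    show ?case by (rule compatible_law_law)
  next
    case (3 \<nu>)
    then show ?case using compatible_unique by blast
  next
    case (4 M U)
    then show ?case by (rule samples(1))
  next
    case (5 M U n)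
    then show ?case by (intro samples(2))
  next
    case (6 M U)
    then show ?case by (rule samples(3))
  next
    case (7 M U m n)
    show ?case by (rule samples(4)[OF 7(1)])
  next
    case (8 M U m n)
    then show ?case by (rule samples(5))
  qed
qed

end
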